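(* Let $G$ be a unicyclic graph of order $n$ (finite, simple, undirected), and let $k$ be the length of the unique cycle of $G$. Then: (i) If $k\equiv 0\pmod 2$, then $s^{+}(G)=s^{-}(G)=n$. (ii) If $k\equiv 3\pmod 4$, then $s^+(G)>n>s^-(G)$. (iii) If $k\equiv 1\pmod 4$, then $s^+(G)<n<s^-(G)$.
   Context: All graphs are finite, simple and undirected. The order of a graph is its number of vertices. A unicyclic graph is a connected graph with $n$ vertices and $n$ edges; it contains exactly one cycle. For a graph $G$ of order $n$, let $\lambda_1(G)\ge \cdots\ge\lambda_n(G)$ be the eigenvalues (with multiplicity) of its adjacency matrix. The positive and negative square energies of $G$ are \[ s^+(G)=\sum_{\lambda_i(G)>0}\lambda_i(G)^2,\qquad s^-(G)=\sum_{\lambda_i(G)<0}\lambda_i(G)^2 . \] *)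

theory Defs
  imports Graph_Theory.Graph_Theory Jordan_Normal_Form.Char_Poly
begin

text \<open>
  A finite simple undirected graph is a value of \<^typ>\<open>'a pair_pre_digraph\<close> satisfying
  \<^locale>\<open>pair_graph\<close>: finite, loop-free, without parallel arcs, and with a symmetric arc relation.
  An undirected edge therefore corresponds to two opposite arcs.
\<close>

definition undirected_edges :: "'a pair_pre_digraph \<Rightarrow> 'a set set" where
  "undirected_edges G = {{u, v} | u v. (u, v) \<in> parcs G}"

definition unicyclic :: "'a pair_pre_digraph \<Rightarrow> bool" where
  "unicyclic G \<longleftrightarrow> pair_graph G \<and> Digraph_Component.connected (with_proj G) \<and>
     card (undirected_edges G) = card (pverts G)"

text \<open>
  In a symmetric digraph the library's \<^const>\<open>pre_digraph.cycle\<close> also holds of the walk that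
  traverses an edge back and forth; the length bound excludes it. The list consists of arcs, so its
  length is the length of the cycle.
\<close>

definition undirected_cycle :: "'a pair_pre_digraph \<Rightarrow> ('a \<times> 'a) awalk \<Rightarrow> bool" where
  "undirected_cycle G c \<longleftrightarrow> pre_digraph.cycle (with_proj G) c \<and> length c \<ge> 3"

definition adjacency_mat :: "'a pair_pre_digraph \<Rightarrow> 'a list \<Rightarrow> real mat" where
  "adjacency_mat G vs = mat (length vs) (length vs)
     (\<lambda>(i, j). if (vs ! i, vs ! j) \<in> parcs G then 1 else 0)"

text \<open>
  The eigenvalues with multiplicity, for an arbitrary enumeration of the vertices; see
  \<open>graph_spectrum_eq\<close> below for the independence of that choice.
  Restricting to real roots loses nothing, as the matrix is symmetric.
\<close>

definition graph_spectrum :: "'a pair_pre_digraph \<Rightarrow> real multiset" where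
  "graph_spectrum G =
     proots (char_poly (adjacency_mat G (SOME vs. distinct vs \<and> set vs = pverts G)))"

definition pos_square_energy :: "'a pair_pre_digraph \<Rightarrow> real" where
  "pos_square_energy G = (\<Sum>x\<in>#filter_mset (\<lambda>x. x > 0) (graph_spectrum G). x\<^sup>2)"

definition neg_square_energy :: "'a pair_pre_digraph \<Rightarrow> real" where
  "neg_square_energy G = (\<Sum>x\<in>#filter_mset (\<lambda>x. x < 0) (graph_spectrum G). x\<^sup>2)"

lemma char_poly_adjacency_mat_cong:
  assumes vs: "distinct vs" "set vs = V" and ws: "distinct ws" "set ws = V"
  shows "char_poly (adjacency_mat G ws) = char_poly (adjacency_mat G vs)"
proof -
  define n where "n = length vs"
  have n: "length ws = n"
    using vs ws unfolding n_def by (metis distinct_card)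
  define M where "M = char_poly_matrix (adjacency_mat G vs)"
  define M' where "M' = char_poly_matrix (adjacency_mat G ws)"
  have M: "M \<in> carrier_mat n n" and M': "M' \<in> carrier_mat n n"
    using n by (auto simp: M_def M'_def n_def adjacency_mat_def char_poly_matrix_def)
  have "mset ws = mset vs"
    using vs ws set_eq_iff_mset_eq_distinct[of ws vs] by simp
  then obtain p where p: "p permutes {..<length vs}" "permute_list p vs = ws"
    by (rule mset_eq_permutation)
  have pn: "p permutes {0..<n}"
    using p(1) by (simp add: n_def lessThan_atLeast0)
  have p_less: "p i < n" if "i < n" for i
    using permutes_in_image[OF pn, of i] that by simp
  have ws_nth: "ws ! i = vs ! p i" if "i < n" for i
    using permute_list_nth[OF p(1), of i] that p(2) by (simp add: n_def)
  have p_inj: "p i = p j \<longleftrightarrow> i = j" for i j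
    using permutes_inj[OF pn] by (auto dest: injD)
  define R where "R = mat n n (\<lambda>(i, j). M $$ (p i, j))"
  have R: "R \<in> carrier_mat n n" by (simp add: R_def)
  have "transpose_mat M' = mat n n (\<lambda>(i, j). transpose_mat R $$ (p i, j))"
    using M M' n p_less by (intro eq_matI)
      (auto simp: R_def M_def M'_def char_poly_matrix_def adjacency_mat_def n_def[symmetric]
                  ws_nth p_inj)
  then have "det M' = signof p * det (transpose_mat R)"
    using det_permute_rows[OF transpose_carrier_mat[THEN iffD2, OF R] pn] det_transpose[OF M'] by simp
  also have "\<dots> = signof p * (signof p * det M)"
    using det_permute_rows[OF M pn] det_transpose[OF R] by (simp add: R_def)
  also have "\<dots> = det M"
    by (simp add: sign_def)
  finally show ?thesis
    by (simp add: char_poly_def M_def M'_def)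
qed

lemma graph_spectrum_eq:
  assumes "distinct vs" "set vs = pverts G"
  shows "graph_spectrum G = proots (char_poly (adjacency_mat G vs))"
proof -
  let ?ws = "SOME vs. distinct vs \<and> set vs = pverts G"
  have "distinct ?ws \<and> set ?ws = pverts G"
    using assms by (intro someI) auto
  then show ?thesis
    unfolding graph_spectrum_def using char_poly_adjacency_mat_cong[OF assms] by metis
qed

end

theory Submission
  imports Defs "HOL-Real_Asymp.Real_Asymp" "Jordan_Normal_Form.Schur_Decomposition"
begin

text \<open>
  Let \<open>\<lambda>\<^sub>1, \<dots>, \<lambda>\<^sub>n\<close> be the eigenvalues of the adjacency matrix \<open>A\<close>. For \<open>t > 0\<close> the argument of
  \<open>det (t I + i A) = \<Prod>\<^sub>j (t + i \<lambda>\<^sub>j)\<close> is \<open>F t = \<Sum>\<^sub>j arctan (\<lambda>\<^sub>j / t)\<close>, which tends to \<open>0\<close> at infinity;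
  by continuity, a constant sign of the imaginary part of the determinant forces the same sign on
  \<open>F\<close>. The integral of \<open>t F t\<close> over \<open>(0, \<infinity>)\<close> equals \<open>- (\<pi> / 4) (s\<^sup>+ - s\<^sup>-)\<close>, while
  \<open>s\<^sup>+ + s\<^sup>- = 2 n\<close> is the trace of \<open>A\<^sup>2\<close>. So everything follows from the sign of \<open>Im (det (t I + i A))\<close>.
  Eliminating the trees hanging off the cycle by Schur complements only replaces \<open>t I\<close> by some other
  positive diagonal, and on the remaining \<open>k\<close>-cycle only the two full rotations contribute to the
  imaginary part of the Leibniz expansion, each by \<open>Im (i\<^sup>k)\<close>.
\<close>

section \<open>Determinants over finite index sets\<close>

text \<open>Indexing by an arbitrary finite set instead of \<open>{0..<n}\<close> lets vertices be deleted without renumbering.\<close>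

definition det_on :: "'a set \<Rightarrow> ('a \<Rightarrow> 'a \<Rightarrow> complex) \<Rightarrow> complex" where
  "det_on V f = (\<Sum>p | p permutes V. of_int (sign p) * (\<Prod>v\<in>V. f v (p v)))"

lemma det_on_cong:
  assumes "\<And>v w. v \<in> V \<Longrightarrow> w \<in> V \<Longrightarrow> f v w = g v w"
  shows "det_on V f = det_on V g"
  unfolding det_on_def
  by (intro sum.cong prod.cong refl arg_cong2[where f = "(*)"] assms)
     (auto simp: permutes_in_image)

lemma permutes_fixing_iff:
  assumes "v \<in> V"
  shows "p permutes V \<and> p v = v \<longleftrightarrow> p permutes (V - {v})"
proof
  assume "p permutes V \<and> p v = v"
  then show "p permutes (V - {v})"
    by (auto intro: permutes_superset)
next
  assume "p permutes (V - {v})"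
  then show "p permutes V \<and> p v = v"
    using permutes_subset[of p "V - {v}" V] permutes_not_in[of p "V - {v}" v] by simp
qed

lemma det_on_fixing:
  assumes V: "finite V" "v \<in> V"
  shows "(\<Sum>p | p permutes V \<and> p v = v. of_int (sign p) * (\<Prod>x\<in>V. f x (p x)))
           = f v v * det_on (V - {v}) f"
proof -
  have "(\<Sum>p | p permutes V \<and> p v = v. of_int (sign p) * (\<Prod>x\<in>V. f x (p x)))
     = (\<Sum>p | p permutes (V - {v}). of_int (sign p) * (f v v * (\<Prod>x\<in>V - {v}. f x (p x))))"
    unfolding permutes_fixing_iff[OF V(2)]
    using V by (intro sum.cong refl) (auto simp: prod.remove permutes_not_in)
  then show ?thesis
    by (simp add: det_on_def sum_distrib_left algebra_simps)
qed

text \<open>Composition with the transposition of \<open>u\<close> and \<open>v\<close> is its own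
  inverse and carries the permutations fixing both points to those exchanging them. It reverses the
  sign, hence the minus.\<close>

lemma det_on_swapping:
  assumes V: "finite V" "v \<in> V" "u \<in> V" "u \<noteq> v"
  shows "(\<Sum>p | p permutes V \<and> p v = u \<and> p u = v. of_int (sign p) * (\<Prod>x\<in>V. f x (p x)))
           = - (f v u * f u v * det_on (V - {u, v}) f)"
proof -
  let ?t = "transpose u v"
  have bij: "bij_betw (\<lambda>q. ?t \<circ> q) {q. q permutes (V - {u, v})}
               {p. p permutes V \<and> p v = u \<and> p u = v}"
  proof (intro bij_betwI[where g = "\<lambda>q. ?t \<circ> q"])
    show "(\<circ>) ?t \<in> {q. q permutes V - {u, v}} \<rightarrow> {p. p permutes V \<and> p v = u \<and> p u = v}"
    proof (intro Pi_I CollectI conjI)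
      fix q assume "q \<in> {q. q permutes V - {u, v}}"
      then have q: "q permutes V - {u, v}" by simp
      have "q permutes V" using q by (rule permutes_subset) auto
      then show "(?t \<circ> q) permutes V"
        using V by (simp add: permutes_compose permutes_swap_id)
      show "(?t \<circ> q) v = u" "(?t \<circ> q) u = v"
        using permutes_not_in[OF q] by simp_all
    qed
    show "(\<circ>) ?t \<in> {p. p permutes V \<and> p v = u \<and> p u = v} \<rightarrow> {q. q permutes V - {u, v}}"
    proof (intro Pi_I CollectI)
      fix p assume "p \<in> {p. p permutes V \<and> p v = u \<and> p u = v}"
      then have p: "p permutes V" "p v = u" "p u = v" by auto
      have "(?t \<circ> p) permutes V"
        using V p by (simp add: permutes_compose permutes_swap_id)
      then show "(?t \<circ> p) permutes (V - {u, v})"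
        by (rule permutes_superset) (use p in auto)
    qed
  qed (auto simp: fun_eq_iff)
  have "(\<Sum>p | p permutes V \<and> p v = u \<and> p u = v. of_int (sign p) * (\<Prod>x\<in>V. f x (p x)))
     = (\<Sum>q | q permutes (V - {u, v}). of_int (sign (?t \<circ> q)) * (\<Prod>x\<in>V. f x ((?t \<circ> q) x)))"
    by (rule sum.reindex_bij_betw[OF bij, symmetric])
  also have "\<dots> = (\<Sum>q | q permutes (V - {u, v}).
       - (f v u * f u v * (of_int (sign q) * (\<Prod>x\<in>V - {u, v}. f x (q x)))))"
  proof (intro sum.cong refl)
    fix q assume "q \<in> {q. q permutes (V - {u, v})}"
    then have q: "q permutes (V - {u, v})" by simp
    have perm: "permutation q"
      using q V(1) by (meson finite_Diff permutation_permutes)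
    have sgn: "sign (?t \<circ> q) = - sign q"
      using V perm by (simp add: sign_compose permutation_swap_id sign_swap_id)
    have "(\<Prod>x\<in>V. f x ((?t \<circ> q) x))
        = f u v * (f v u * (\<Prod>x\<in>V - {u} - {v}. f x ((?t \<circ> q) x)))"
      using V q by (simp add: prod.remove[of V u] prod.remove[of "V - {u}" v] permutes_not_in)
    also have "V - {u} - {v} = V - {u, v}" by auto
    also have "(\<Prod>x\<in>V - {u, v}. f x ((?t \<circ> q) x)) = (\<Prod>x\<in>V - {u, v}. f x (q x))"
    proof (intro prod.cong refl)
      fix x assume "x \<in> V - {u, v}"
      then have "q x \<in> V - {u, v}" using permutes_in_image[OF q] by blast
      then show "f x ((?t \<circ> q) x) = f x (q x)" by (simp add: transpose_def)
    qed
    finally show "of_int (sign (?t \<circ> q)) * (\<Prod>x\<in>V. f x ((?t \<circ> q) x))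
      = - (f v u * f u v * (of_int (sign q) * (\<Prod>x\<in>V - {u, v}. f x (q x))))"
      by (simp add: sgn)
  qed
  finally show ?thesis
    by (simp add: det_on_def sum_distrib_left sum_negf)
qed

text \<open>The determinant is affine in a single diagonal entry: only permutations fixing
  \<open>u\<close> see the entry at \<open>(u, u)\<close>, and their remaining factors sum to the
  minor.\<close>

lemma det_on_diag_add:
  assumes V: "finite V" "u \<in> V"
    and off: "\<And>v w. v \<in> V \<Longrightarrow> w \<in> V \<Longrightarrow> (v, w) \<noteq> (u, u) \<Longrightarrow> g v w = f v w"
  shows "det_on V g = det_on V f + (g u u - f u u) * det_on (V - {u}) f"
proof -
  let ?T = "\<lambda>f p. of_int (sign p) * (\<Prod>x\<in>V. f x (p x)) :: complex"
  have fin: "finite {p. p permutes V}" using V by (simp add: finite_permutations)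
  have split: "det_on V h = (\<Sum>p | p permutes V \<and> p u = u. ?T h p)
      + (\<Sum>p | p permutes V \<and> p u \<noteq> u. ?T h p)" for h
    using sum.Int_Diff[OF fin, of "?T h" "{p. p u = u}"]
    by (simp add: det_on_def Int_def set_diff_eq)
  have "(\<Sum>p | p permutes V \<and> p u \<noteq> u. ?T g p) = (\<Sum>p | p permutes V \<and> p u \<noteq> u. ?T f p)"
    by (intro sum.cong prod.cong refl arg_cong2[where f = "(*)"] off) (auto simp: permutes_in_image)
  moreover have "det_on (V - {u}) g = det_on (V - {u}) f"
    by (intro det_on_cong off) auto
  ultimately show ?thesis
    unfolding split det_on_fixing[OF V] by (simp add: algebra_simps)
qed

text \<open>This is one step of a Schur complement. Row and column \<open>v\<close> vanish outside
  \<open>u\<close> and \<open>v\<close>, so a nonzero Leibniz term either fixes \<open>v\<close> or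
  exchanges it with \<open>u\<close>; eliminating \<open>v\<close> therefore alters the rest only at
  \<open>(u, u)\<close>.\<close>

lemma det_on_leaf:
  assumes V: "finite V" "v \<in> V" "u \<in> V" "u \<noteq> v" and fvv: "f v v \<noteq> 0"
    and row: "\<And>w. w \<in> V - {u, v} \<Longrightarrow> f v w = 0"
    and col: "\<And>w. w \<in> V - {u, v} \<Longrightarrow> f w v = 0"
    and diag: "g u u = f u u - f u v * f v u / f v v"
    and off: "\<And>x y. x \<in> V - {v} \<Longrightarrow> y \<in> V - {v} \<Longrightarrow> (x, y) \<noteq> (u, u) \<Longrightarrow> g x y = f x y"
  shows "det_on V f = f v v * det_on (V - {v}) g"
proof -
  let ?T = "\<lambda>p. of_int (sign p) * (\<Prod>x\<in>V. f x (p x)) :: complex"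
  let ?A = "{p. p permutes V \<and> p v = v}" and ?B = "{p. p permutes V \<and> p v = u \<and> p u = v}"
  have fin: "finite {p. p permutes V}" using V by (simp add: finite_permutations)
  have "det_on V f = sum ?T (?A \<union> ?B)"
    unfolding det_on_def
  proof (intro sum.mono_neutral_right fin ballI)
    fix p assume "p \<in> {p. p permutes V} - (?A \<union> ?B)"
    then have p: "p permutes V" and nA: "p v \<noteq> v" and nB: "p v = u \<Longrightarrow> p u \<noteq> v" by auto
    \<comment> \<open>If \<open>p v = u\<close> without \<open>p u = v\<close>, the zero factor sits
      in column \<open>v\<close>, at the preimage \<open>w\<close> of \<open>v\<close>; otherwise it
      sits in row \<open>v\<close>.\<close>
    obtain w where w: "w \<in> V" "p w = v"
      using p V(2) by (metis permutes_in_image permutes_surj surjD)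
    have "\<exists>x\<in>V. f x (p x) = 0"
    proof (cases "p v = u")
      case True
      then have "w \<in> V - {u, v}" using w nA nB by auto
      then show ?thesis using col[of w] w by auto
    next
      case False
      then have "p v \<in> V - {u, v}" using nA p V(2) by (auto simp: permutes_in_image)
      then show ?thesis using row V(2) by auto
    qed
    then show "?T p = 0" using V(1) by auto
  qed auto
  also have "\<dots> = sum ?T ?A + sum ?T ?B"
    using V(4) by (intro sum.union_disjoint) (auto intro: finite_subset[OF _ fin])
  also have "\<dots> = f v v * det_on (V - {v}) f - f v u * f u v * det_on (V - {u, v}) f"
    using det_on_fixing[OF V(1,2)] det_on_swapping[OF V] by simp
  also have "V - {u, v} = V - {v} - {u}" by auto
  also have "f v v * det_on (V - {v}) f - f v u * f u v * det_on (V - {v} - {u}) f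
      = f v v * det_on (V - {v}) g"
    \<comment> \<open>The two terms are \<open>f v v\<close> times the expansion of the determinant
      of \<open>g\<close> around that of \<open>f\<close> in the entry at
      \<open>(u, u)\<close>.\<close>
    using V fvv by (subst det_on_diag_add[of "V - {v}" u g f]) (auto simp: off diag field_simps)
  finally show ?thesis .
qed

lemma det_on_reindex:
  assumes h: "bij_betw h W V" and W: "finite W"
  shows "det_on V f = det_on W (\<lambda>x y. f (h x) (h y))"
proof -
  have inj: "inj_on h W" and im: "h ` W = V" using h by (auto simp: bij_betw_def)
  have bij: "bij_betw (map_permutation W h) {p. p permutes W} {p. p permutes V}"
    using bij_betw_permutations[OF h] unfolding map_permutation_def restrict_id_def im
    by (simp add: o_def cong: if_cong)
  show ?thesis
    unfolding det_on_def
  proof (subst sum.reindex_bij_betw[OF bij, symmetric], intro sum.cong refl)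
    fix p assume "p \<in> {p. p permutes W}"
    then have p: "p permutes W" by simp
    have "(\<Prod>v\<in>V. f v (map_permutation W h p v)) = (\<Prod>x\<in>W. f (h x) (map_permutation W h p (h x)))"
      by (rule prod.reindex_bij_betw[OF h, symmetric])
    also have "\<dots> = (\<Prod>x\<in>W. f (h x) (h (p x)))"
      using inj by (intro prod.cong refl) (simp add: map_permutation_apply)
    finally show "of_int (sign (map_permutation W h p)) * (\<Prod>v\<in>V. f v (map_permutation W h p v))
        = of_int (sign p) * (\<Prod>x\<in>W. f (h x) (h (p x)))"
      using sign_map_permutation[OF inj p W] by simp
  qed
qed
lemma det_eq_det_on:
  assumes "A \<in> carrier_mat n n"
  shows "det A = det_on {0..<n} (\<lambda>i j. A $$ (i, j))"
  using assms by (simp add: det_def det_on_def)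

section \<open>Cycles with hanging trees\<close>

text \<open>This generalises t I + i A to an arbitrary real diagonal, a form that is preserved when
  leaves are eliminated.\<close>

definition weighted_mat :: "('a \<Rightarrow> real) \<Rightarrow> ('a \<Rightarrow> 'a \<Rightarrow> bool) \<Rightarrow> 'a \<Rightarrow> 'a \<Rightarrow> complex" where
  "weighted_mat d E v w = (if v = w then of_real (d v) else if E v w then \<i> else 0)"

text \<open>The pairs \<open>{x, p x}\<close> partition the moved points into blocks of size
  two.\<close>

lemma even_card_moved_if_involution:
  assumes "finite V" and p: "\<And>x. x \<in> V \<Longrightarrow> p x \<in> V \<and> p (p x) = x"
  shows "even (card {x \<in> V. p x \<noteq> x})"
proof -
  let ?M = "{x \<in> V. p x \<noteq> x}"
  have un: "\<Union>((\<lambda>x. {x, p x}) ` ?M) = ?M" using p by auto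
  have "2 dvd card (\<Union>((\<lambda>x. {x, p x}) ` ?M))"
  proof (rule dvd_partition)
    show "finite (\<Union>((\<lambda>x. {x, p x}) ` ?M))" unfolding un using assms(1) by simp
    show "\<forall>c\<in>(\<lambda>x. {x, p x}) ` ?M. 2 dvd card c" by (auto simp: card_insert_if)
    show "\<forall>c1\<in>(\<lambda>x. {x, p x}) ` ?M. \<forall>c2\<in>(\<lambda>x. {x, p x}) ` ?M. c1 \<noteq> c2 \<longrightarrow> c1 \<inter> c2 = {}"
    proof (intro ballI impI)
      have cls: "{x, p x} = {z, p z}" if "x \<in> V" "z \<in> {x, p x}" for x z
        using p[OF that(1)] that(2) by auto
      fix c1 c2 assume "c1 \<in> (\<lambda>x. {x, p x}) ` ?M" "c2 \<in> (\<lambda>x. {x, p x}) ` ?M" and ne: "c1 \<noteq> c2"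
      then obtain x y where xy: "x \<in> V" "y \<in> V" "c1 = {x, p x}" "c2 = {y, p y}" by auto
      show "c1 \<inter> c2 = {}"
        using cls[OF xy(1)] cls[OF xy(2)] ne unfolding xy(3,4) by blast
    qed
  qed
  then show ?thesis unfolding un .
qed

text \<open>Conjugation fixes the diagonal entries and negates the others, which are 0 or
  \<open>\<i>\<close>. An involution moves an even number of points, so the product equals its own
  conjugate.\<close>

lemma Im_term_involution:
  assumes "finite V" and p: "\<And>x. x \<in> V \<Longrightarrow> p x \<in> V \<and> p (p x) = x"
  shows "Im (of_int (sign p) * (\<Prod>v\<in>V. weighted_mat d E v (p v))) = 0"
proof -
  have "cnj (\<Prod>v\<in>V. weighted_mat d E v (p v))
      = (\<Prod>v\<in>V. (if p v \<noteq> v then -1 else 1) * weighted_mat d E v (p v))"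
    unfolding cnj_prod by (intro prod.cong) (auto simp: weighted_mat_def)
  also have "\<dots> = (\<Prod>v\<in>V. if p v \<noteq> v then -1 else 1) * (\<Prod>v\<in>V. weighted_mat d E v (p v))"
    by (rule prod.distrib)
  also have "(\<Prod>v\<in>V. if p v \<noteq> v then -1 else 1) = (-1 :: complex) ^ card {x \<in> V. p x \<noteq> x}"
    using assms(1) by (simp add: prod.inter_filter[symmetric])
  also have "\<dots> = 1"
    using even_card_moved_if_involution[OF assms] by simp
  finally have "cnj (\<Prod>v\<in>V. weighted_mat d E v (p v)) = (\<Prod>v\<in>V. weighted_mat d E v (p v))"
    by simp
  then have "Im (\<Prod>v\<in>V. weighted_mat d E v (p v)) = 0"
    by (metis Reals_cnj_iff complex_is_Real_iff)
  then show ?thesis by simp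
qed

section \<open>Permutations that move along the edges of a cycle\<close>

definition cyc_adj :: "nat \<Rightarrow> nat \<Rightarrow> nat \<Rightarrow> bool" where
  "cyc_adj k i j \<longleftrightarrow> j = Suc i mod k \<or> i = Suc j mod k"

text \<open>For \<open>k = 2\<close> two forward steps would lead back to the start, and a rotation
  would be an involution; a length of at least 3 rules this out.\<close>

lemma Suc_mod_neq:
  assumes "i < k" "3 \<le> k"
  shows "Suc i mod k \<noteq> i" "Suc (Suc i mod k) mod k \<noteq> i"
  using assms by (auto simp: mod_Suc)

text \<open>A single forward step that is not undone propagates around the cycle. The next vertex is
  already an image, so by injectivity it cannot stay put; it must not step back either, so it steps
  forward, and again injectivity keeps that step from being undone.\<close>

lemma forward_step_imp_rotation:
  assumes k: "3 \<le> k" and p: "p permutes {0..<k}"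
    and adj: "\<And>i. i < k \<Longrightarrow> p i = i \<or> cyc_adj k i (p i)"
    and j: "j < k" "p j = Suc j mod k" "p (p j) \<noteq> j"
    and i: "i < k"
  shows "p i = Suc i mod k"
proof -
  have inj: "p x = p y \<longleftrightarrow> x = y" for x y
    using permutes_inj[OF p] by (auto dest: injD)
  have Suc_inj: "x = y" if "x < k" "y < k" "Suc x mod k = Suc y mod k" for x y
    using that by (auto simp: mod_Suc split: if_splits)
  have rot: "p ((j + m) mod k) = Suc ((j + m) mod k) mod k \<and>
      p (Suc ((j + m) mod k) mod k) \<noteq> (j + m) mod k" for m
  proof (induction m)
    case 0
    then show ?case using j by simp
  next
    case (Suc m)
    define a where "a = (j + m) mod k"
    define b where "b = Suc a mod k"
    have ab: "a < k" "b < k" using k by (auto simp: a_def b_def)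
    have pab: "p a = b" "p b \<noteq> a" using Suc by (auto simp: a_def b_def)
    have ne: "b \<noteq> a" "Suc b mod k \<noteq> a"
      using Suc_mod_neq[OF ab(1) k] by (auto simp: b_def)
    have "p b < k" using ab permutes_in_image[OF p] by auto
    moreover have "p b \<noteq> b" using inj[of b a] pab ne by auto
    ultimately have pb: "p b = Suc b mod k"
      using adj[OF ab(2)] pab(2) Suc_inj[OF ab(1), of "p b"]
      unfolding cyc_adj_def b_def[symmetric] by metis
    have "p (Suc b mod k) \<noteq> b" using inj[of "Suc b mod k" a] pab(1) ne(2) by auto
    moreover have "(j + Suc m) mod k = b" by (simp add: a_def b_def mod_Suc_eq)
    ultimately show ?case using pb by simp
  qed
  \<comment> \<open>Since \<open>j < k\<close>, the natural subtraction is exact and the total is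
    \<open>k + i\<close>.\<close>
  have "(j + (k - j + i)) mod k = i" using i j(1) by simp
  then show ?thesis using rot[of "k - j + i"] by simp
qed

text \<open>A point to which \<open>p\<close> does not return after two steps has moved to a
  neighbour. If that step was forward, \<open>p\<close> is the rotation; if it was backward, the
  inverse of \<open>p\<close> makes a forward step at \<open>p j\<close>, and the same argument
  applies to the inverse.\<close>

lemma cycle_permutation_cases:
  assumes k: "3 \<le> k" and p: "p permutes {0..<k}"
    and adj: "\<And>i. i < k \<Longrightarrow> p i = i \<or> cyc_adj k i (p i)"
    and j: "j < k" "p (p j) \<noteq> j"
  shows "(\<forall>i<k. p i = Suc i mod k) \<or> (\<forall>i<k. inv_into UNIV p i = Suc i mod k)"
proof -
  have "p j = Suc j mod k \<or> j = Suc (p j) mod k"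
    using adj[OF j(1)] j(2) by (auto simp: cyc_adj_def)
  then show ?thesis
  proof
    assume "p j = Suc j mod k"
    then show ?thesis
      using forward_step_imp_rotation[OF k p adj j(1) _ j(2)] by blast
  next
    assume pre: "j = Suc (p j) mod k"
    note ip = permutes_inv[OF p] and io = permutes_inverses[OF p]
    have "inv_into UNIV p i = i \<or> cyc_adj k i (inv_into UNIV p i)" if "i < k" for i
    proof -
      have "inv_into UNIV p i < k" using that permutes_in_image[OF ip] by auto
      then show ?thesis using adj[of "inv_into UNIV p i"] by (auto simp: io cyc_adj_def)
    qed
    moreover have "p j < k" using j(1) permutes_in_image[OF p] by auto
    moreover have "inv_into UNIV p (p j) = Suc (p j) mod k" using pre by (simp add: io)
    moreover have "inv_into UNIV p (inv_into UNIV p (p j)) \<noteq> p j" using j(2) by (metis io)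
    ultimately show ?thesis
      using forward_step_imp_rotation[OF k ip] by blast
  qed
qed

text \<open>The \<open>k\<close>-th power of the rotation is the identity, so the sign is a
  \<open>k\<close>-th root of 1 among 1 and -1; for odd \<open>k\<close> this leaves only 1.\<close>

lemma sign_rotation:
  assumes k: "odd k" and p: "p permutes {0..<k}" and rot: "\<And>i. i < k \<Longrightarrow> p i = Suc i mod k"
  shows "sign p = 1"
proof -
  have k0: "k > 0" using k by (cases k) auto
  have iter: "(p ^^ m) i = (i + m) mod k" if "i < k" for i m
    using that k0 by (induction m) (auto simp: rot mod_Suc_eq)
  have pow: "(p ^^ m) permutes {0..<k}" for m
    by (induction m) (simp_all add: permutes_id[unfolded id_def] permutes_compose[OF _ p, unfolded o_def] o_def id_def)
  have perm: "permutation (p ^^ m)" for m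
    using pow by (metis finite_atLeastLessThan permutation_permutes)
  have "sign (p ^^ m) = sign p ^ m" for m
  proof (induction m)
    case (Suc m)
    then show ?case using sign_compose[OF perm[of 1] perm[of m]] by (simp add: o_def)
  qed (simp add: sign_id)
  moreover have "p ^^ k = id"
  proof
    fix x show "(p ^^ k) x = id x"
    proof (cases "x < k")
      case False
      then show ?thesis using permutes_not_in[OF pow[of k], of x] by simp
    qed (simp add: iter)
  qed
  ultimately have "sign p ^ k = 1" by (metis sign_id)
  moreover have "sign p = 1 \<or> sign p = -1" by (simp add: sign_def)
  ultimately show ?thesis using k by auto
qed

text \<open>A Leibniz term vanishes if some vertex moves to a non-neighbour, and is real if the
  permutation is an involution. The others are rotations, collected in \<open>R\<close>; each
  contributes the imaginary part of \<open>\<i> ^ k\<close>, and the factor \<open>r\<close> is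
  their number.\<close>

lemma Im_det_cycle:
  assumes k: "3 \<le> k"
  shows "\<exists>r>0. Im (det_on {0..<k} (weighted_mat d (cyc_adj k))) = r * Im (\<i> ^ k)"
proof -
  let ?f = "weighted_mat d (cyc_adj k)"
  let ?T = "\<lambda>p. of_int (sign p) * (\<Prod>v\<in>{0..<k}. ?f v (p v)) :: complex"
  let ?P = "{p. p permutes {0..<k}}"
  define R where "R = {p. p permutes {0..<k} \<and> (\<forall>i<k. p i = i \<or> cyc_adj k i (p i)) \<and>
    (\<exists>i<k. p (p i) \<noteq> i)}"
  have fin: "finite ?P" by (simp add: finite_permutations)
  have finR: "finite R" by (rule finite_subset[OF _ fin]) (auto simp: R_def)
  have out: "Im (?T p) = 0" if "p \<in> ?P - R" for p
  proof (cases "\<forall>i<k. p i = i \<or> cyc_adj k i (p i)")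
    case True
    then show ?thesis
      using that by (intro Im_term_involution) (auto simp: R_def permutes_in_image)
  next
    case False
    then obtain i where "i < k" "?f i (p i) = 0" by (auto simp: weighted_mat_def)
    then have zero: "(\<Prod>v\<in>{0..<k}. ?f v (p v)) = 0" by (intro prod_zero) auto
    show ?thesis unfolding zero by simp
  qed
  have inR: "Im (?T p) = Im (\<i> ^ k)" if "p \<in> R" for p
  proof -
    from that obtain j where p: "p permutes {0..<k}" and j: "j < k" "p (p j) \<noteq> j"
      and adj: "\<And>i. i < k \<Longrightarrow> p i = i \<or> cyc_adj k i (p i)" by (auto simp: R_def)
    note rot = cycle_permutation_cases[OF k p adj j]
    \<comment> \<open>A rotation moves every vertex, so the diagonal \<open>d\<close> does not enter
      its term and all factors are \<open>\<i>\<close>.\<close>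
    have ne: "p i \<noteq> i" if "i < k" for i
      using rot that Suc_mod_neq[OF that k] permutes_inverses[OF p] by metis
    have "(\<Prod>v\<in>{0..<k}. ?f v (p v)) = (\<Prod>v\<in>{0..<k}. \<i>)"
      using ne adj by (intro prod.cong) (auto simp: weighted_mat_def dest: ne[symmetric])
    then have T: "?T p = of_int (sign p) * \<i> ^ k" by simp
    show ?thesis
    proof (cases "even k")
      case True
      \<comment> \<open>For even \<open>k\<close> the power is real, so both imaginary parts are 0
        whatever the sign of \<open>p\<close>.\<close>
      then obtain m where "k = 2 * m" by auto
      then have ik: "\<i> ^ k = of_int ((-1) ^ m)" by (simp add: power_mult)
      show ?thesis unfolding T ik of_int_mult[symmetric] by (simp only: complex_Im_of_int)
    next
      case False
      have "sign p = 1"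
        using rot
      proof
        assume "\<forall>i<k. inv_into UNIV p i = Suc i mod k"
        then have "sign (inv_into UNIV p) = 1" using sign_rotation[OF False permutes_inv[OF p]] by blast
        then show ?thesis
          using p by (metis finite_atLeastLessThan permutation_permutes sign_inverse)
      next
        assume "\<forall>i<k. p i = Suc i mod k"
        then show ?thesis using sign_rotation[OF False p] by blast
      qed
      then show ?thesis using T by simp
    qed
  qed
  have "R \<noteq> {}"
  proof -
    \<comment> \<open>The forward rotation, extended by the identity, witnesses that
      \<open>R\<close> is nonempty, so that the factor is positive.\<close>
    define q where "q i = (if i < k then Suc i mod k else i)" for i
    have inj: "inj_on q {0..<k}" and sub: "q ` {0..<k} \<subseteq> {0..<k}"
      using k by (auto simp: q_def inj_on_def mod_Suc split: if_splits)
    have "q permutes {0..<k}"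
    proof (rule bij_imp_permutes)
      show "bij_betw q {0..<k} {0..<k}"
        unfolding bij_betw_def using inj endo_inj_surj[OF _ sub inj] by simp
    qed (simp add: q_def)
    moreover have "q (q 0) \<noteq> 0" using k by (simp add: q_def)
    moreover have "q i = i \<or> cyc_adj k i (q i)" if "i < k" for i
      using that by (simp add: q_def cyc_adj_def)
    moreover have "0 < k" using k by simp
    ultimately have "q \<in> R" unfolding R_def by blast
    then show ?thesis by auto
  qed
  then have "card R > 0" using finR by (simp add: card_gt_0_iff)
  moreover have "Im (det_on {0..<k} ?f) = (\<Sum>p\<in>?P. Im (?T p))"
    unfolding det_on_def by (rule Im_sum)
  moreover have "\<dots> = (\<Sum>p\<in>R. Im (?T p))"
    using out by (intro sum.mono_neutral_right fin) (auto simp: R_def)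
  moreover have "\<dots> = of_nat (card R) * Im (\<i> ^ k)" using inR by simp
  ultimately show ?thesis by (intro exI[of _ "of_nat (card R)"]) simp
qed

section \<open>Elimination of the hanging trees\<close>

text \<open>Induction on the number of vertices outside \<open>C\<close>. One of maximal height
  \<open>h\<close> is nobody's parent, hence a leaf attached to its own parent, and
  \<open>det_on_leaf\<close> removes it at the price of a positive factor and a changed diagonal.
  This is why \<open>base\<close> is assumed for every positive diagonal on
  \<open>C\<close>.\<close>

lemma Im_det_hanging_trees:
  fixes h :: "'a \<Rightarrow> nat" and s :: real
  assumes "finite V" "C \<subseteq> V"
    and edge: "\<And>v w. v \<in> V \<Longrightarrow> w \<in> V \<Longrightarrow> E v w \<Longrightarrow>
      v \<in> C \<and> w \<in> C \<or> v \<notin> C \<and> w = par v \<or> w \<notin> C \<and> v = par w"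
    and par: "\<And>v. v \<in> V - C \<Longrightarrow> par v \<in> V \<and> E v (par v) \<and> E (par v) v \<and> h (par v) < h v"
    and base: "\<And>d. (\<And>v. v \<in> C \<Longrightarrow> d v > 0) \<Longrightarrow>
      \<exists>r>0. Im (det_on C (weighted_mat d E)) = r * s"
    and d: "\<And>v. v \<in> V \<Longrightarrow> d v > 0"
  shows "\<exists>r>0. Im (det_on V (weighted_mat d E)) = r * s"
  using assms(1,2) edge par d
proof (induction "card (V - C)" arbitrary: V d)
  case 0
  then have "V = C" by auto
  then show ?case using base 0 by simp
next
  case (Suc n)
  note edge = Suc.prems(3) and par = Suc.prems(4) and d = Suc.prems(5)
  have fin: "finite (V - C)" and "V - C \<noteq> {}" using Suc by auto
  then obtain v where v: "v \<in> V - C" and max: "\<And>w. w \<in> V - C \<Longrightarrow> h w \<le> h v"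
    using Max_in[of "h ` (V - C)"] Max_ge[of "h ` (V - C)"] by fastforce
  define u where "u = par v"
  have u: "u \<in> V" "E v u" "E u v" "u \<noteq> v" using par[OF v] by (auto simp: u_def)
  have leaf: "\<not> E v w \<and> \<not> E w v" if "w \<in> V - {u, v}" for w
  proof -
    have "\<not> (w \<notin> C \<and> v = par w)" using par[of w] max[of w] that by fastforce
    then show ?thesis using edge[of v w] edge[of w v] that v by (auto simp: u_def)
  qed
  have child: "par w \<noteq> v" if "w \<in> V - {v} - C" for w
    using par[of w] max[of w] that by fastforce
  \<comment> \<open>Because \<open>\<i>\<close> squares to -1, the Schur correction is added to the
    diagonal entry, which stays positive.\<close>
  define d' where "d' = d(u := d u + 1 / d v)"
  have eq: "det_on V (weighted_mat d E) = of_real (d v) * det_on (V - {v}) (weighted_mat d' E)"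
    using Suc.prems(1) v u leaf d[of v]
    by (subst det_on_leaf[of V v u _ "weighted_mat d' E"])
       (auto simp: weighted_mat_def d'_def field_simps)
  have "\<exists>r>0. Im (det_on (V - {v}) (weighted_mat d' E)) = r * s"
  proof (rule Suc.hyps(1))
    have "V - {v} - C = (V - C) - {v}" by auto
    then show "n = card (V - {v} - C)" using Suc.hyps(2) fin v by simp
    show "par w \<in> V - {v} \<and> E w (par w) \<and> E (par w) w \<and> h (par w) < h w"
      if "w \<in> V - {v} - C" for w using par[of w] child that by auto
    show "0 < d' w" if "w \<in> V - {v}" for w
      using d[of w] d[of v] that v by (auto simp: d'_def add_pos_pos)
  qed (use Suc.prems(1,2) v edge in auto)
  then obtain r where "r > 0" "Im (det_on (V - {v}) (weighted_mat d' E)) = r * s" by auto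
  then show ?case
    using d[of v] v by (intro exI[of _ "d v * r"]) (simp add: eq)
qed

section \<open>Arguments and signed squares\<close>

text \<open>A continuous branch of the argument of the product of the factors t + i x for
  \<open>t > 0\<close>, not reduced modulo 2 pi.\<close>

definition arctan_sum :: "real list \<Rightarrow> real \<Rightarrow> real" where
  "arctan_sum xs t = (\<Sum>x\<leftarrow>xs. arctan (x / t))"

lemma prod_list_eq_cis_arctan_sum:
  assumes "t > 0"
  shows "\<exists>r>0. (\<Prod>x\<leftarrow>xs. of_real t + \<i> * of_real x) = of_real r * cis (arctan_sum xs t)"
proof (induction xs)
  case Nil
  show ?case by (intro exI[of _ 1]) (simp add: arctan_sum_def)
next
  case (Cons x xs)
  then obtain r where r: "r > 0"
    "(\<Prod>x\<leftarrow>xs. of_real t + \<i> * of_real x) = of_real r * cis (arctan_sum xs t)" by auto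
  let ?s = "t * sqrt (1 + (x / t)\<^sup>2)"
  have pos: "sqrt (1 + (x / t)\<^sup>2) > 0" by (simp add: add_pos_nonneg)
  have "of_real t + \<i> * of_real x = of_real ?s * cis (arctan (x / t))"
    using assms pos by (simp add: complex_eq_iff cos_arctan sin_arctan)
  then show ?case
    using assms pos r
    by (intro exI[of _ "?s * r"]) (simp add: arctan_sum_def cis_mult[symmetric] mult_ac)
qed

lemma tendsto_sum_list:
  fixes f :: "'a \<Rightarrow> 'b \<Rightarrow> 'c::topological_monoid_add"
  assumes "\<And>x. x \<in> set xs \<Longrightarrow> (f x \<longlongrightarrow> l x) F"
  shows "((\<lambda>t. \<Sum>x\<leftarrow>xs. f x t) \<longlongrightarrow> (\<Sum>x\<leftarrow>xs. l x)) F"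
  using assms by (induction xs) (auto intro!: tendsto_intros)

lemma arctan_sum_at_top: "(arctan_sum xs \<longlongrightarrow> 0) at_top"
proof -
  have "((\<lambda>t. arctan (x / t)) \<longlongrightarrow> arctan 0) at_top" for x :: real
    by (intro tendsto_arctan tendsto_divide_0[OF tendsto_const]
        filterlim_at_top_imp_at_infinity filterlim_ident)
  then have "((\<lambda>t. \<Sum>x\<leftarrow>xs. arctan (x / t)) \<longlongrightarrow> (\<Sum>x\<leftarrow>xs. 0)) at_top"
    by (intro tendsto_sum_list) simp
  then show ?thesis by (simp add: arctan_sum_def[abs_def])
qed

lemma continuous_on_arctan_sum: "continuous_on {0<..} (arctan_sum xs)"
proof -
  have "continuous_on {0<..} (\<lambda>t. \<Sum>x\<leftarrow>xs. arctan (x / t))"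
    by (induction xs) (auto intro!: continuous_intros)
  then show ?thesis by (simp add: arctan_sum_def[abs_def])
qed

text \<open>The sine determines the angle only modulo 2 pi. But a positive value at
  \<open>t\<close>, together with the decay to 0 at infinity, would make the continuous angle pass
  through a value strictly between 0 and pi, where the sine is positive.\<close>

lemma arctan_sum_nonpos:
  assumes sin: "\<And>t. t > 0 \<Longrightarrow> sin (arctan_sum xs t) \<le> 0" and t: "t > 0"
  shows "arctan_sum xs t \<le> 0"
proof (rule ccontr)
  assume neg: "\<not> ?thesis"
  \<comment> \<open>The cap at pi / 2 keeps \<open>y\<close> below pi even if the angle at
    \<open>t\<close> exceeds pi.\<close>
  define y where "y = min (arctan_sum xs t) (pi / 2)"
  have y: "0 < y" "y < pi" "y \<le> arctan_sum xs t"
    using neg pi_gt_zero by (auto simp: y_def min_less_iff_disj)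
  have "eventually (\<lambda>s. arctan_sum xs s < y \<and> s > t) at_top"
    using order_tendstoD(2)[OF arctan_sum_at_top y(1)] eventually_gt_at_top
    by (rule eventually_conj)
  from eventually_happens'[OF trivial_limit_at_top_linorder this]
  obtain s where s: "arctan_sum xs s < y" "t < s" by auto
  have "\<exists>x. t \<le> x \<and> x \<le> s \<and> arctan_sum xs x = y"
    using s y t
    by (intro IVT2' continuous_on_subset[OF continuous_on_arctan_sum]) auto
  then obtain x where "t \<le> x" "arctan_sum xs x = y" by auto
  then have "sin y \<le> 0" using sin[of x] t by simp
  then show False using sin_gt_zero[OF y(1,2)] by simp
qed

section \<open>An explicit primitive of t arctan (x / t) and its limits\<close>

text \<open>Integration by parts yields this primitive; the constant of integration is chosen so
  that it tends to 0 at 0 from the right.\<close>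

definition arctan_primitive :: "real \<Rightarrow> real \<Rightarrow> real" where
  "arctan_primitive x t = t\<^sup>2 / 2 * arctan (x / t) + x * t / 2 - x\<^sup>2 / 2 * arctan (t / x)"

lemma arctan_primitive_uminus: "arctan_primitive (- x) t = - arctan_primitive x t"
  by (simp add: arctan_primitive_def arctan_minus)

lemma has_real_derivative_arctan_primitive:
  assumes "t > 0"
  shows "(arctan_primitive x has_real_derivative t * arctan (x / t)) (at t)"
proof (cases "x = 0")
  case True
  then show ?thesis by (simp add: arctan_primitive_def[abs_def])
next
  case False
  have sum: "t\<^sup>2 + x\<^sup>2 > 0" using assms by (simp add: add_pos_nonneg)
  have "((\<lambda>t. arctan (x / t)) has_real_derivative inverse (1 + (x / t)\<^sup>2) * (- x / t\<^sup>2)) (at t)"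
    using assms by (intro DERIV_chain2[OF DERIV_arctan])
      (auto intro!: derivative_eq_intros simp: power2_eq_square)
  also have "inverse (1 + (x / t)\<^sup>2) * (- x / t\<^sup>2) = - x / (t\<^sup>2 + x\<^sup>2)"
    using assms sum by (simp add: divide_simps)
  finally have d1: "((\<lambda>t. arctan (x / t)) has_real_derivative - x / (t\<^sup>2 + x\<^sup>2)) (at t)" .
  have "((\<lambda>t. arctan (t / x)) has_real_derivative inverse (1 + (t / x)\<^sup>2) * (1 / x)) (at t)"
    using False by (intro DERIV_chain2[OF DERIV_arctan]) (auto intro!: derivative_eq_intros)
  also have "inverse (1 + (t / x)\<^sup>2) * (1 / x) = x / (t\<^sup>2 + x\<^sup>2)"
    using False sum by (simp add: divide_simps) (simp add: field_simps power2_eq_square)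
  finally have d2: "((\<lambda>t. arctan (t / x)) has_real_derivative x / (t\<^sup>2 + x\<^sup>2)) (at t)" .
  have "((\<lambda>t. t\<^sup>2 / 2 * arctan (x / t) + x * t / 2 - x\<^sup>2 / 2 * arctan (t / x)) has_real_derivative
      (t * arctan (x / t) + t\<^sup>2 / 2 * (- x / (t\<^sup>2 + x\<^sup>2)) + x / 2
       - x\<^sup>2 / 2 * (x / (t\<^sup>2 + x\<^sup>2)))) (at t)"
  proof -
    have "((\<lambda>t. t\<^sup>2 / 2) has_real_derivative t) (at t)"
      and "((\<lambda>t. x * t / 2) has_real_derivative x / 2) (at t)"
      by (auto intro!: derivative_eq_intros)
    then show ?thesis
      by (intro DERIV_cong[OF DERIV_diff[OF DERIV_add[OF DERIV_mult[OF _ d1]]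
          DERIV_cmult[OF d2, of "x\<^sup>2 / 2"]]]) (auto simp: mult_ac)
  qed
  also have "t * arctan (x / t) + t\<^sup>2 / 2 * (- x / (t\<^sup>2 + x\<^sup>2)) + x / 2
       - x\<^sup>2 / 2 * (x / (t\<^sup>2 + x\<^sup>2))
     = t * arctan (x / t) + x / 2 - x * (t\<^sup>2 + x\<^sup>2) / (2 * (t\<^sup>2 + x\<^sup>2))"
    by (simp add: add_divide_distrib ring_distribs mult_ac)
  also have "\<dots> = t * arctan (x / t)"
    using sum nonzero_mult_divide_mult_cancel_right[of "t\<^sup>2 + x\<^sup>2" x 2] by linarith
  finally show ?thesis by (simp add: arctan_primitive_def[abs_def])
qed

lemma arctan_primitive_at_0: "(arctan_primitive x \<longlongrightarrow> 0) (at_right 0)"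
proof -
  have pos: "(arctan_primitive x \<longlongrightarrow> 0) (at_right 0)" if "x > 0" for x
    using that unfolding arctan_primitive_def[abs_def] by real_asymp
  \<comment> \<open>The asymptotic computation is done for positive \<open>x\<close>; the primitive
    is odd in \<open>x\<close>, which settles negative \<open>x\<close>.\<close>
  consider "x > 0" | "x = 0" | "-x > 0" by linarith
  then show ?thesis
  proof cases
    case 1
    then show ?thesis by (rule pos)
  next
    case 3
    then show ?thesis
      using tendsto_minus[OF pos[of "-x"]] by (simp add: arctan_primitive_uminus)
  qed (simp add: arctan_primitive_def[abs_def])
qed

text \<open>The first two summands together grow like \<open>x * t\<close>. Once this is subtracted,
  what survives is the limit pi / 2 or -pi / 2 of \<open>arctan (t / x)\<close>, whose sign turns
  the square of \<open>x\<close> into \<open>x * \<bar>x\<bar>\<close>.\<close>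

lemma arctan_primitive_at_top:
  "((\<lambda>t. arctan_primitive x t - x * t) \<longlongrightarrow> - (pi / 4) * (x * \<bar>x\<bar>)) at_top"
proof -
  have pos: "((\<lambda>t. arctan_primitive x t - x * t) \<longlongrightarrow> - (pi / 4) * (x * \<bar>x\<bar>)) at_top" if "x > 0" for x
    using that unfolding arctan_primitive_def[abs_def] by (real_asymp simp: power2_eq_square)
  consider "x > 0" | "x = 0" | "-x > 0" by linarith
  then show ?thesis
  proof cases
    case 1
    then show ?thesis by (rule pos)
  next
    case 3
    then show ?thesis
      using tendsto_minus[OF pos[of "-x"]] by (simp add: arctan_primitive_uminus)
  qed (simp add: arctan_primitive_def[abs_def])
qed

text \<open>The primitive \<open>H\<close> of \<open>t * ?F t\<close> decreases weakly because the
  angle is nonpositive. It starts from the limit 0 and ends at -(pi / 4) times the sum in question,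
  which is therefore nonnegative.\<close>

lemma sum_signed_squares_nonneg:
  fixes xs :: "real list"
  assumes sum0: "sum_list xs = 0"
    and Im: "\<And>t. t > 0 \<Longrightarrow> Im (\<Prod>x\<leftarrow>xs. of_real t + \<i> * of_real x) \<le> 0"
  shows "(\<Sum>x\<leftarrow>xs. x * \<bar>x\<bar>) \<ge> 0"
    and "(\<And>t. t > 0 \<Longrightarrow> Im (\<Prod>x\<leftarrow>xs. of_real t + \<i> * of_real x) < 0) \<Longrightarrow>
      (\<Sum>x\<leftarrow>xs. x * \<bar>x\<bar>) > 0"
proof -
  let ?F = "arctan_sum xs"
  define H where "H t = (\<Sum>x\<leftarrow>xs. arctan_primitive x t)" for t
  define S where "S = (\<Sum>x\<leftarrow>xs. x * \<bar>x\<bar>)"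
  have polar: "\<exists>r>0. Im (\<Prod>x\<leftarrow>xs. of_real t + \<i> * of_real x) = r * sin (?F t)" if "t > 0" for t
    using prod_list_eq_cis_arctan_sum[OF that, of xs] by auto
  have "sin (?F t) \<le> 0" if "t > 0" for t
    using polar[OF that] Im[OF that] by (auto simp: mult_le_0_iff)
  then have F: "?F t \<le> 0" if "t > 0" for t
    using arctan_sum_nonpos that by blast
  have deriv: "(H has_real_derivative t * ?F t) (at t)" if "t > 0" for t
  proof -
    have "((\<lambda>t. \<Sum>x\<leftarrow>xs. arctan_primitive x t) has_real_derivative
        (\<Sum>x\<leftarrow>xs. t * arctan (x / t))) (at t)"
      by (induction xs) (auto intro!: derivative_intros has_real_derivative_arctan_primitive that)
    then show ?thesis
      by (simp add: H_def[abs_def] arctan_sum_def sum_list_const_mult)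
  qed
  have antimono: "H b \<le> H a" if "0 < a" "a \<le> b" for a b
  proof (rule DERIV_nonpos_imp_nonincreasing[OF that(2)])
    fix x assume "a \<le> x" "x \<le> b"
    then have "x > 0" using that by simp
    then show "\<exists>y. DERIV H x :> y \<and> y \<le> 0"
      using deriv F[of x] by (intro exI[of _ "x * ?F x"] conjI) (auto simp: mult_le_0_iff)
  qed
  have lim0: "(H \<longlongrightarrow> 0) (at_right 0)"
    using tendsto_sum_list[of xs arctan_primitive "\<lambda>_. 0" "at_right 0"] arctan_primitive_at_0
    by (simp add: H_def[abs_def])
  have "((\<lambda>t. \<Sum>x\<leftarrow>xs. arctan_primitive x t - x * t) \<longlongrightarrow>
      (\<Sum>x\<leftarrow>xs. - (pi / 4) * (x * \<bar>x\<bar>))) at_top"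
    by (intro tendsto_sum_list arctan_primitive_at_top)
  \<comment> \<open>The linear growth terms cancel because the list sums to 0.\<close>
  also have "(\<lambda>t. \<Sum>x\<leftarrow>xs. arctan_primitive x t - x * t) = H"
    using sum0 sum_list_mult_const[of "\<lambda>x. x" _ xs]
    by (simp add: sum_list_subtractf H_def[abs_def])
  also have "(\<Sum>x\<leftarrow>xs. - (pi / 4) * (x * \<bar>x\<bar>)) = - (pi / 4) * S"
    by (simp only: S_def sum_list_const_mult)
  finally have lim: "(H \<longlongrightarrow> - (pi / 4) * S) at_top" .
  have H_le: "H t \<le> 0" if "t > 0" for t
  proof (rule tendsto_lowerbound[OF lim0])
    show "eventually (\<lambda>s. H t \<le> H s) (at_right 0)"
      using that antimono by (intro eventually_at_rightI[of 0 t]) auto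
  qed simp
  have le_H: "- (pi / 4) * S \<le> H t" if "t > 0" for t
  proof (rule tendsto_upperbound[OF lim])
    show "eventually (\<lambda>s. H s \<le> H t) at_top"
      using that antimono by (intro eventually_mono[OF eventually_ge_at_top[of t]]) auto
  qed simp
  have "- (pi / 4) * S \<le> 0" using H_le[of 1] le_H[of 1] by linarith
  then show "S \<ge> 0" using pi_gt_zero by (simp add: zero_le_mult_iff)
  show "S > 0" if strict: "\<And>t. t > 0 \<Longrightarrow> Im (\<Prod>x\<leftarrow>xs. of_real t + \<i> * of_real x) < 0"
  proof -
    have neg: "?F t < 0" if "t > 0" for t
      using polar[OF that] strict[OF that] F[OF that] by (cases "?F t = 0") auto
    \<comment> \<open>A strict drop on one interval suffices, since the limits bound
      \<open>H\<close> by 0 above and by -(pi / 4) \<open>S\<close> below.\<close>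
    have "H 2 < H 1"
    proof (rule DERIV_neg_imp_decreasing[of 1 2])
      fix x :: real assume "1 \<le> x" "x \<le> 2"
      then show "\<exists>y. DERIV H x :> y \<and> y < 0"
        using deriv[of x] neg[of x] by (intro exI[of _ "x * ?F x"] conjI) (auto simp: mult_less_0_iff)
    qed simp
    then have "- (pi / 4) * S < 0" using H_le[of 1] le_H[of 2] by linarith
    then show ?thesis using pi_gt_zero by (simp add: zero_less_mult_iff)
  qed
qed

text \<open>Negating the list conjugates the product and negates the signed sum, which reduces this
  to the previous lemma.\<close>

lemma sum_signed_squares_nonpos:
  fixes xs :: "real list"
  assumes sum0: "sum_list xs = 0"
    and Im: "\<And>t. t > 0 \<Longrightarrow> Im (\<Prod>x\<leftarrow>xs. of_real t + \<i> * of_real x) \<ge> 0"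
  shows "(\<Sum>x\<leftarrow>xs. x * \<bar>x\<bar>) \<le> 0"
    and "(\<And>t. t > 0 \<Longrightarrow> Im (\<Prod>x\<leftarrow>xs. of_real t + \<i> * of_real x) > 0) \<Longrightarrow>
      (\<Sum>x\<leftarrow>xs. x * \<bar>x\<bar>) < 0"
proof -
  let ?ys = "map uminus xs"
  have "(\<Prod>x\<leftarrow>?ys. of_real t + \<i> * of_real x) = cnj (\<Prod>x\<leftarrow>xs. of_real t + \<i> * of_real x)" for t
    by (induction xs) simp_all
  then have Im_ys: "Im (\<Prod>x\<leftarrow>?ys. of_real t + \<i> * of_real x)
      = - Im (\<Prod>x\<leftarrow>xs. of_real t + \<i> * of_real x)" for t by simp
  have sum_ys: "sum_list ?ys = 0" "(\<Sum>x\<leftarrow>?ys. x * \<bar>x\<bar>) = - (\<Sum>x\<leftarrow>xs. x * \<bar>x\<bar>)"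
    using sum0 uminus_sum_list_map[of "\<lambda>x. x" xs] uminus_sum_list_map[of "\<lambda>x. x * \<bar>x\<bar>" xs]
    by (simp_all add: o_def)
  note * = sum_signed_squares_nonneg[OF sum_ys(1), unfolded Im_ys sum_ys(2)]
  show "(\<Sum>x\<leftarrow>xs. x * \<bar>x\<bar>) \<le> 0" using *(1) Im by simp
  show "(\<Sum>x\<leftarrow>xs. x * \<bar>x\<bar>) < 0" if "\<And>t. t > 0 \<Longrightarrow> Im (\<Prod>x\<leftarrow>xs. of_real t + \<i> * of_real x) > 0"
    using *(2) that Im by simp
qed

section \<open>Spectra of symmetric real matrices\<close>

text \<open>For an eigenvector v, the Hermitian form \<open>q\<close> = v* A v is real by symmetry
  and equals \<open>a\<close> times the nonzero squared norm \<open>N\<close>.\<close>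

lemma symmetric_real_eigenvalue:
  fixes A :: "real mat"
  assumes A: "A \<in> carrier_mat n n"
    and sym: "\<And>i j. i < n \<Longrightarrow> j < n \<Longrightarrow> A $$ (i, j) = A $$ (j, i)"
    and ev: "eigenvalue (map_mat of_real A) (a :: complex)"
  shows "a \<in> \<real>"
proof -
  from ev A obtain v where v: "v \<in> carrier_vec n" "v \<noteq> 0\<^sub>v n"
    and Av: "map_mat of_real A *\<^sub>v v = a \<cdot>\<^sub>v v"
    unfolding eigenvalue_def eigenvector_def by auto
  define q where "q = (\<Sum>i<n. cnj (v $ i) * (\<Sum>j<n. of_real (A $$ (i, j)) * v $ j))"
  define N where "N = (\<Sum>i<n. (cmod (v $ i))\<^sup>2)"
  have row: "(\<Sum>j<n. of_real (A $$ (i, j)) * v $ j) = a * v $ i" if "i < n" for i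
  proof -
    have "(map_mat of_real A *\<^sub>v v) $ i = (\<Sum>j<n. of_real (A $$ (i, j)) * v $ j)"
      using A v(1) that by (simp add: scalar_prod_def lessThan_atLeast0)
    then show ?thesis using Av v(1) that by simp
  qed
  have "q = (\<Sum>i<n. cnj (v $ i) * (a * v $ i))"
    unfolding q_def by (intro sum.cong) (simp_all add: row)
  also have "\<dots> = a * of_real N"
    unfolding N_def of_real_sum sum_distrib_left
    by (intro sum.cong) (simp_all only: complex_norm_square mult_ac)
  finally have qN: "q = a * of_real N" .
  have "cnj q = (\<Sum>i<n. \<Sum>j<n. v $ i * of_real (A $$ (i, j)) * cnj (v $ j))"
    by (simp add: q_def sum_distrib_left mult_ac)
  also have "\<dots> = (\<Sum>j<n. \<Sum>i<n. v $ i * of_real (A $$ (i, j)) * cnj (v $ j))"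
    by (rule sum.swap)
  also have "\<dots> = q"
    unfolding q_def sum_distrib_left
    by (intro sum.cong refl) (simp add: sym mult_ac)
  finally have "q \<in> \<real>" by (simp add: Reals_cnj_iff)
  moreover have "N \<noteq> 0"
  proof
    assume "N = 0"
    then have "\<forall>i<n. v $ i = 0" by (auto simp: N_def sum_nonneg_eq_0_iff)
    then show False using v by auto
  qed
  ultimately show ?thesis using qN
    by (metis Reals_divide Reals_of_real nonzero_mult_div_cancel_right of_real_eq_0_iff)
qed

text \<open>The polynomial splits over the complex numbers with real roots only, and the coefficient
  embedding is injective, so the factorisation descends to the reals.\<close>

lemma symmetric_real_char_poly_splits:
  fixes A :: "real mat"
  assumes A: "A \<in> carrier_mat n n"
    and sym: "\<And>i j. i < n \<Longrightarrow> j < n \<Longrightarrow> A $$ (i, j) = A $$ (j, i)"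
  shows "\<exists>xs. char_poly A = (\<Prod>x\<leftarrow>xs. [:- x, 1:])"
proof -
  let ?B = "map_mat of_real A :: complex mat"
  have B: "?B \<in> carrier_mat n n" using A by simp
  interpret h: map_poly_inj_idom_hom "of_real :: real \<Rightarrow> complex" ..
  obtain as where as: "char_poly ?B = (\<Prod>a\<leftarrow>as. [:- a, 1:])"
    using char_poly_factorized[OF B] by auto
  have real: "a \<in> \<real>" if "a \<in> set as" for a
  proof (rule symmetric_real_eigenvalue[OF A sym])
    show "eigenvalue ?B a"
      unfolding eigenvalue_root_char_poly[OF B] as poly_prod_list using that
      by (auto simp: prod_list_zero_iff)
  qed
  have "map_poly of_real (char_poly A) = char_poly ?B"
    by (rule of_real_hom.char_poly_hom[OF A, symmetric])
  also have "\<dots> = (\<Prod>a\<leftarrow>map (of_real \<circ> Re) as. [:- a, 1:])"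
    unfolding as using real by (intro arg_cong[where f = prod_list]) (auto simp: o_def)
  also have "\<dots> = map_poly of_real (\<Prod>x\<leftarrow>map Re as. [:- x, 1:])"
    by (simp add: h.hom_prod_list o_def)
  finally show ?thesis by (intro exI[of _ "map Re as"]) (simp only: h.eq_iff)
qed

lemma proots_prod_linear: "proots (\<Prod>x\<leftarrow>xs. [:- x, 1:]) = mset (xs :: 'a :: idom list)"
proof (induction xs)
  case (Cons x xs)
  have "(\<Prod>x\<leftarrow>xs. [:- x, 1:]) \<noteq> 0" by (auto simp: prod_list_zero_iff)
  then show ?case using Cons by (simp add: proots_mult del: mult_pCons_left)
qed simp

section \<open>Traces of a matrix and of its square\<close>

text \<open>The trace of a square matrix.\<close>

definition diag_sum :: "'a :: comm_monoid_add mat \<Rightarrow> 'a" where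
  "diag_sum A = (\<Sum>i<dim_row A. A $$ (i, i))"

lemma diag_sum_mult:
  assumes "A \<in> carrier_mat n n" "B \<in> carrier_mat n n"
  shows "diag_sum (A * B) = (\<Sum>i<n. \<Sum>j<n. A $$ (i, j) * B $$ (j, i))"
  using assms by (simp add: diag_sum_def scalar_prod_def lessThan_atLeast0)

lemma diag_sum_mult_commute:
  fixes A B :: "'a :: comm_semiring_0 mat"
  assumes "A \<in> carrier_mat n n" "B \<in> carrier_mat n n"
  shows "diag_sum (A * B) = diag_sum (B * A)"
  unfolding diag_sum_mult[OF assms] diag_sum_mult[OF assms(2,1)]
  by (subst sum.swap) (simp add: mult.commute)

lemma diag_sum_similar:
  fixes A B :: "'a :: comm_ring_1 mat"
  assumes "similar_mat A B"
  shows "diag_sum A = diag_sum B"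
proof -
  from similar_matD[OF assms] obtain n P Q where
    c: "A \<in> carrier_mat n n" "B \<in> carrier_mat n n" "P \<in> carrier_mat n n" "Q \<in> carrier_mat n n"
    and QP: "Q * P = 1\<^sub>m n" and A: "A = P * B * Q" by auto
  have "diag_sum A = diag_sum (Q * (P * B))"
    unfolding A using c by (intro diag_sum_mult_commute[of _ n]) auto
  also have "Q * (P * B) = B"
    using c QP by (simp add: assoc_mult_mat[of _ n n _ n _ n, symmetric])
  finally show ?thesis .
qed

lemma similar_mat_square:
  fixes A B :: "'a :: comm_ring_1 mat"
  assumes "similar_mat A B"
  shows "similar_mat (A * A) (B * B)"
proof -
  from similar_matD[OF assms] obtain n P Q where
    c: "A \<in> carrier_mat n n" "B \<in> carrier_mat n n" "P \<in> carrier_mat n n" "Q \<in> carrier_mat n n"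
    and QP: "P * Q = 1\<^sub>m n" "Q * P = 1\<^sub>m n" and A: "A = P * B * Q" by auto
  have "A * A = P * B * (Q * P) * B * Q"
    unfolding A using c by (simp add: assoc_mult_mat[of _ n n _ n _ n])
  also have "\<dots> = P * (B * B) * Q"
    unfolding QP using c by (simp add: assoc_mult_mat[of _ n n _ n _ n])
  finally show ?thesis using c QP by (intro similar_matI[of _ _ P Q n]) auto
qed

text \<open>The Schur decomposition gives a similar upper triangular \<open>T\<close> with diagonal
  \<open>xs\<close>. In the trace of \<open>T * T\<close>, every product of entries at (i, j) and
  (j, i) with distinct indices has a factor below the diagonal, so only the squares remain.\<close>

lemma diag_sum_split_char_poly:
  fixes A :: "real mat"
  assumes A: "A \<in> carrier_mat n n" and cp: "char_poly A = (\<Prod>x\<leftarrow>xs. [:- x, 1:])"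
  shows "diag_sum A = sum_list xs" and "diag_sum (A * A) = (\<Sum>x\<leftarrow>xs. x\<^sup>2)"
proof -
  obtain T P Q where "schur_decomposition A xs = (T, P, Q)"
    by (cases "schur_decomposition A xs") auto
  from schur_decomposition[OF A cp this]
  have sim: "similar_mat A T" and ut: "upper_triangular T" and diag: "diag_mat T = xs"
    and T: "T \<in> carrier_mat n n"
    using similar_mat_witD2[OF A] unfolding similar_mat_def by auto
  have xs: "length xs = n" "\<And>i. i < n \<Longrightarrow> xs ! i = T $$ (i, i)"
    using T unfolding diag[symmetric] diag_mat_def by auto
  have "diag_sum T = sum_list xs"
    using T xs by (simp add: diag_sum_def sum_list_sum_nth lessThan_atLeast0)
  then show "diag_sum A = sum_list xs" using diag_sum_similar[OF sim] by simp
  have "diag_sum (T * T) = (\<Sum>i<n. \<Sum>j<n. if j = i then (T $$ (i, i))\<^sup>2 else 0)"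
    unfolding diag_sum_mult[OF T T]
  proof (intro sum.cong refl)
    fix i j assume "i \<in> {..<n}" "j \<in> {..<n}"
    then have "j < i \<Longrightarrow> T $$ (i, j) = 0" "i < j \<Longrightarrow> T $$ (j, i) = 0"
      using ut T by (auto dest: upper_triangularD)
    then show "T $$ (i, j) * T $$ (j, i) = (if j = i then (T $$ (i, i))\<^sup>2 else 0)"
      by (cases i j rule: linorder_cases) (auto simp: power2_eq_square)
  qed
  also have "\<dots> = (\<Sum>x\<leftarrow>xs. x\<^sup>2)"
    using xs by (simp add: sum_list_sum_nth lessThan_atLeast0)
  finally show "diag_sum (A * A) = (\<Sum>x\<leftarrow>xs. x\<^sup>2)"
    using diag_sum_similar[OF similar_mat_square[OF sim]] by simp
qed

text \<open>The matrix is -i times (i t I - A), so its determinant is the characteristic polynomial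
  at i t multiplied by the \<open>n\<close>-th power of -i.\<close>

lemma det_shifted_imaginary:
  fixes A :: "real mat"
  assumes A: "A \<in> carrier_mat n n" and cp: "char_poly A = (\<Prod>x\<leftarrow>xs. [:- x, 1:])"
  shows "det (of_real t \<cdot>\<^sub>m 1\<^sub>m n + \<i> \<cdot>\<^sub>m map_mat of_real A)
           = (\<Prod>x\<leftarrow>xs. of_real t + \<i> * of_real x :: complex)"
proof -
  let ?B = "map_mat of_real A :: complex mat"
  have B: "?B \<in> carrier_mat n n" using A by simp
  interpret h: map_poly_inj_idom_hom "of_real :: real \<Rightarrow> complex" ..
  have "char_poly ?B = map_poly of_real (\<Prod>x\<leftarrow>xs. [:- x, 1:])"
    unfolding cp[symmetric] by (rule of_real_hom.char_poly_hom[OF A])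
  also have "\<dots> = (\<Prod>x\<leftarrow>xs. [:- of_real x, 1:])" by (simp add: h.hom_prod_list o_def)
  finally have cpB: "char_poly ?B = (\<Prod>x\<leftarrow>xs. [:- of_real x, 1:])" .
  have poly: "poly (\<Prod>x\<leftarrow>xs. [:- of_real x, 1:]) z = (\<Prod>x\<leftarrow>xs. z - of_real x)" for z :: complex
    by (induction xs) (simp_all add: algebra_simps)
  \<comment> \<open>There are as many roots as factors \<open>- \<i>\<close>, so one of these can be
    absorbed into each linear factor.\<close>
  have len: "length xs = n"
    using degree_monic_char_poly[OF A] degree_linear_factors[of uminus xs] cp by simp
  have "of_real t \<cdot>\<^sub>m 1\<^sub>m n + \<i> \<cdot>\<^sub>m ?B = (- \<i>) \<cdot>\<^sub>m (- char_matrix ?B (\<i> * of_real t))"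
    using A by (intro eq_matI) (auto simp: char_matrix_def algebra_simps)
  then have "det (of_real t \<cdot>\<^sub>m 1\<^sub>m n + \<i> \<cdot>\<^sub>m ?B) = (- \<i>) ^ n * poly (char_poly ?B) (\<i> * of_real t)"
    using A by (simp add: char_poly_matrix[OF B] char_matrix_def)
  also have "\<dots> = (\<Prod>x\<leftarrow>xs. (- \<i>) * (\<i> * of_real t - of_real x))"
    unfolding cpB poly len[symmetric] by (induction xs) (simp_all add: algebra_simps)
  also have "\<dots> = (\<Prod>x\<leftarrow>xs. of_real t + \<i> * of_real x)"
    by (simp add: algebra_simps)
  finally show ?thesis .
qed

section \<open>Unicyclic graphs\<close>

text \<open>Every undirected edge is the image of exactly two arcs, distinct by
  irreflexivity.\<close>

lemma card_symmetric_rel: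
  assumes "finite R" and sym: "\<And>u v. (u, v) \<in> R \<Longrightarrow> (v, u) \<in> R" and irr: "\<And>v. (v, v) \<notin> R"
  shows "card R = 2 * card {{u, v} | u v. (u, v) \<in> R}"
proof -
  let ?e = "\<lambda>(u, v). {u, v}"
  have img: "{{u, v} | u v. (u, v) \<in> R} = ?e ` R" by (auto simp: image_iff)
  have "card R = (\<Sum>e\<in>?e ` R. \<Sum>x | x \<in> R \<and> ?e x = e. 1)"
    unfolding card_eq_sum using assms(1) by (rule sum.image_gen)
  also have "\<dots> = (\<Sum>e\<in>?e ` R. 2)"
  proof (intro sum.cong refl)
    fix e assume "e \<in> ?e ` R"
    then obtain u v where uv: "(u, v) \<in> R" "e = {u, v}" by auto
    then have "{x. x \<in> R \<and> ?e x = e} = {(u, v), (v, u)}" 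
      using sym by (auto simp: doubleton_eq_iff)
    moreover have "u \<noteq> v" using uv irr by auto
    ultimately show "(\<Sum>x | x \<in> R \<and> ?e x = e. 1) = (2::nat)" by simp
  qed
  finally show ?thesis by (simp add: img)
qed

text \<open>Here \<open>h\<close> is the distance to the cycle, and \<open>par\<close> picks a
  neighbour closer to it. Cycle edges and parent edges are pairwise distinct and already as many as
  the vertices, so the edge count leaves no room for a further edge.\<close>

lemma connected_unicyclic_structure:
  fixes R :: "('a \<times> 'a) set" and ys :: "'a list"
  defines "C \<equiv> set ys" and "k \<equiv> length ys"
  assumes V: "finite V" "R \<subseteq> V \<times> V" "C \<subseteq> V"
    and ys: "distinct ys" "3 \<le> k" "\<And>i. i < k \<Longrightarrow> (ys ! i, ys ! (Suc i mod k)) \<in> R"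
    and conn: "\<And>v. v \<in> V \<Longrightarrow> \<exists>w\<in>C. (v, w) \<in> R\<^sup>*"
    and card: "card {{u, v} | u v. (u, v) \<in> R} = card V"
  shows "\<exists>par (h :: 'a \<Rightarrow> nat).
    (\<forall>v\<in>V - C. par v \<in> V \<and> (v, par v) \<in> R \<and> h (par v) < h v) \<and>
    (\<forall>v w. (v, w) \<in> R \<longrightarrow>
      (\<exists>i<k. {v, w} = {ys ! i, ys ! (Suc i mod k)}) \<or> v \<notin> C \<and> w = par v \<or> w \<notin> C \<and> v = par w)"
proof -
  define h where "h v = (LEAST m. \<exists>w\<in>C. (v, w) \<in> R ^^ m)" for v
  have ex: "\<exists>m. \<exists>w\<in>C. (v, w) \<in> R ^^ m" if "v \<in> V" for v
    using conn[OF that] by (meson rtrancl_imp_relpow)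
  have "\<exists>u. u \<in> V \<and> (v, u) \<in> R \<and> h u < h v" if v: "v \<in> V - C" for v
  proof -
    have "\<exists>w\<in>C. (v, w) \<in> R ^^ h v"
      unfolding h_def using LeastI_ex[OF ex[of v]] v by simp
    then obtain w where w: "w \<in> C" "(v, w) \<in> R ^^ h v" by blast
    then obtain m where m: "h v = Suc m" using v by (cases "h v") auto
    then obtain u where u: "(v, u) \<in> R" "(u, w) \<in> R ^^ m"
      using w(2) relpow_Suc_D2[of v w m R] by auto
    then have "h u \<le> m" unfolding h_def using w(1) by (intro Least_le) blast
    then show ?thesis using u V(2) m by auto
  qed
  then obtain par where par: "\<And>v. v \<in> V - C \<Longrightarrow> par v \<in> V \<and> (v, par v) \<in> R \<and> h (par v) < h v"
    by metis
  let ?E = "{{u, v} | u v. (u, v) \<in> R}"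
  let ?c = "\<lambda>i. {ys ! i, ys ! (Suc i mod k)}" and ?t = "\<lambda>v. {v, par v}"
  let ?S = "?c ` {0..<k}" and ?T = "?t ` (V - C)"
  have k0: "0 < k" using ys(2) by simp
  have Suc_less: "Suc i mod k < k" for i using k0 by simp
  have nth_eq: "ys ! i = ys ! j \<longleftrightarrow> i = j" if "i < k" "j < k" for i j
    using that ys(1) by (simp add: k_def nth_eq_iff_index_eq)
  have injc: "inj_on ?c {0..<k}"
  proof (rule inj_onI)
    fix i j assume ij: "i \<in> {0..<k}" "j \<in> {0..<k}" and "?c i = ?c j"
    \<comment> \<open>In the second case two forward steps from \<open>j\<close> would return to
      \<open>j\<close>.\<close>
    then have "i = j \<or> i = Suc j mod k \<and> Suc i mod k = j"
      by (auto simp: doubleton_eq_iff nth_eq Suc_less)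
    then show "i = j" using Suc_mod_neq(2)[OF _ ys(2), of j] ij by auto
  qed
  have injt: "inj_on ?t (V - C)"
  proof (rule inj_onI)
    fix v w assume vw: "v \<in> V - C" "w \<in> V - C" and "?t v = ?t w"
    \<comment> \<open>Two vertices cannot be parents of each other, since \<open>h\<close> would
      decrease both ways.\<close>
    then have "v = w \<or> v = par w \<and> par v = w" by (auto simp: doubleton_eq_iff)
    then show "v = w" using par[OF vw(1)] par[OF vw(2)] by auto
  qed
  have "?c i \<subseteq> C" if "i < k" for i
    using that Suc_less[of i] by (auto simp: C_def k_def)
  then have disj: "?S \<inter> ?T = {}" by fastforce
  have "finite R" using V(1,2) by (meson finite_SigmaI finite_subset)
  moreover have "?E = (\<lambda>(u, v). {u, v}) ` R" by (auto simp: image_iff)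
  ultimately have finE: "finite ?E" by simp
  \<comment> \<open>The \<open>k\<close> cycle edges and the \<open>card V - k\<close> parent edges already exhaust all \<open>card V\<close> edges.\<close>
  have "?S \<union> ?T \<subseteq> ?E" using ys(3) par by fastforce
  moreover have "card (?S \<union> ?T) = card ?E"
  proof -
    have "card (?S \<union> ?T) = card ?S + card ?T"
      using V(1) by (intro card_Un_disjoint disj) auto
    also have "\<dots> = card C + card (V - C)"
      using card_image[OF injc] card_image[OF injt] distinct_card[OF ys(1)]
      by (simp add: C_def k_def)
    also have "\<dots> = card V"
      using V(1,3) by (metis card_Un_disjoint Diff_disjoint Diff_partition finite_Diff finite_subset)
    finally show ?thesis using card by simp
  qed
  ultimately have E: "?S \<union> ?T = ?E" using finE by (intro card_subset_eq) auto
  show ?thesis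
  proof (intro exI[of _ par] exI[of _ h] conjI ballI allI impI)
    fix v assume "v \<in> V - C"
    then show "par v \<in> V" "(v, par v) \<in> R" "h (par v) < h v" using par by auto
  next
    fix v w assume "(v, w) \<in> R"
    then have "{v, w} \<in> ?S \<union> ?T" unfolding E by blast
    then show "(\<exists>i<k. {v, w} = ?c i) \<or> v \<notin> C \<and> w = par v \<or> w \<notin> C \<and> v = par w"
    proof
      assume "{v, w} \<in> ?S"
      then show ?thesis by auto
    next
      assume "{v, w} \<in> ?T"
      then obtain x where "x \<in> V - C" "{v, w} = {x, par x}" by auto
      then show ?thesis by (auto simp: doubleton_eq_iff)
    qed
  qed
qed

section \<open>From closed arc walks to vertex lists\<close>

lemma cas_with_proj_nth:
  assumes "pre_digraph.cas (with_proj G) u p v"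
  shows "p \<noteq> [] \<Longrightarrow> fst (p ! 0) = u" and "p \<noteq> [] \<Longrightarrow> snd (last p) = v"
    and "Suc i < length p \<Longrightarrow> fst (p ! Suc i) = snd (p ! i)"
proof -
  have "(p \<noteq> [] \<longrightarrow> fst (p ! 0) = u \<and> snd (last p) = v) \<and>
      (\<forall>i. Suc i < length p \<longrightarrow> fst (p ! Suc i) = snd (p ! i))"
    using assms
  proof (induction p arbitrary: u)
    case (Cons a p)
    then have IH: "(p \<noteq> [] \<longrightarrow> fst (p ! 0) = snd a \<and> snd (last p) = v) \<and>
      (\<forall>i. Suc i < length p \<longrightarrow> fst (p ! Suc i) = snd (p ! i))" and "fst a = u"
      and "p = [] \<longrightarrow> snd a = v"
      by (auto simp: pre_digraph.cas.simps)
    then show ?case by (auto simp: nth_Cons split: nat.split)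
  qed simp
  then show "p \<noteq> [] \<Longrightarrow> fst (p ! 0) = u" "p \<noteq> [] \<Longrightarrow> snd (last p) = v"
    "Suc i < length p \<Longrightarrow> fst (p ! Suc i) = snd (p ! i)" by auto
qed

lemma undirected_cycle_vertices:
  assumes "undirected_cycle G c"
  obtains ys where "length ys = length c" "distinct ys" "3 \<le> length ys"
    "\<And>i. i < length ys \<Longrightarrow> (ys ! i, ys ! (Suc i mod length ys)) \<in> parcs G"
proof -
  from assms obtain u where len: "3 \<le> length c" and arcs: "set c \<subseteq> parcs G"
    and cas: "pre_digraph.cas (with_proj G) u c u"
    and dist: "distinct (tl (pre_digraph.awalk_verts (with_proj G) u c))"
    unfolding undirected_cycle_def pre_digraph.cycle_def pre_digraph.awalk_def by auto
  have ne: "c \<noteq> []" using len by auto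
  \<comment> \<open>Heads are listed rather than tails because the cycle predicate asserts
    distinctness of the tail of the vertex list, which consists of the heads. The arc leaving entry
    \<open>i\<close> is thus \<open>c ! Suc i\<close>, and \<open>c ! 0\<close> closes the
    cycle.\<close>
  let ?ys = "map snd c"
  have "distinct ?ys"
    using dist ne pre_digraph.awalk_verts_conv'[OF cas] by simp
  moreover have "(?ys ! i, ?ys ! (Suc i mod length ?ys)) \<in> parcs G" if "i < length ?ys" for i
  proof (cases "Suc i < length c")
    case True
    then have "(snd (c ! i), snd (c ! Suc i)) = c ! Suc i"
      using cas_with_proj_nth(3)[OF cas True] by (simp add: prod_eq_iff)
    then show ?thesis using True arcs nth_mem[OF True] by auto
  next
    case False
    then have i: "i = length c - 1" "Suc i = length c" using that by auto
    have "(snd (c ! i), snd (c ! 0)) = c ! 0"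
      using cas_with_proj_nth(1,2)[OF cas ne] ne by (simp add: prod_eq_iff i last_conv_nth)
    then show ?thesis using ne arcs i nth_mem[of 0 c] by auto
  qed
  ultimately show ?thesis using that[of ?ys] len by simp
qed

lemma Im_i_power:
  "even k \<Longrightarrow> Im (\<i> ^ k) = 0" "k mod 4 = 3 \<Longrightarrow> Im (\<i> ^ k) = -1" "k mod 4 = 1 \<Longrightarrow> Im (\<i> ^ k) = 1"
proof -
  have "\<i> ^ k = (\<i> ^ 4) ^ (k div 4) * \<i> ^ (k mod 4)"
    by (metis mult_div_mod_eq power_add power_mult)
  moreover have "\<i> ^ 4 = 1" by (simp add: eval_nat_numeral)
  ultimately have red: "\<i> ^ k = \<i> ^ (k mod 4)" by simp
  show "Im (\<i> ^ k) = -1" if "k mod 4 = 3" unfolding red that by (simp add: eval_nat_numeral)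
  show "Im (\<i> ^ k) = 1" if "k mod 4 = 1" unfolding red that by simp
  show "Im (\<i> ^ k) = 0" if "even k"
  proof -
    from that have "k mod 4 = 0 \<or> k mod 4 = 2" by presburger
    then show ?thesis unfolding red by auto
  qed
qed

text \<open>The edge structure allows all trees to be eliminated down to the cycle vertices;
  numbering these along the cycle gives the model cycle on \<open>{0..<k}\<close>.\<close>

lemma Im_det_unicyclic:
  fixes G :: "'a pair_pre_digraph"
  assumes G: "unicyclic G" and c: "undirected_cycle G c" and t: "t > 0"
  shows "\<exists>r>0. Im (det_on (pverts G) (weighted_mat (\<lambda>_. t) (\<lambda>v w. (v, w) \<in> parcs G)))
    = r * Im (\<i> ^ length c)"
proof -
  let ?V = "pverts G" and ?R = "parcs G" and ?E = "\<lambda>v w. (v, w) \<in> parcs G"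
  from G have pg: "pair_graph G" and conn: "Digraph_Component.connected (with_proj G)"
    and card: "card {{u, v} | u v. (u, v) \<in> ?R} = card ?V"
    unfolding unicyclic_def undirected_edges_def by auto
  interpret pair_graph G by (rule pg)
  obtain ys where len: "length ys = length c" and ys: "distinct ys" "3 \<le> length ys"
    and cyc: "\<And>i. i < length ys \<Longrightarrow> (ys ! i, ys ! (Suc i mod length ys)) \<in> ?R"
    using undirected_cycle_vertices[OF c] by blast
  let ?k = "length ys" and ?C = "set ys"
  have RV: "?R \<subseteq> ?V \<times> ?V" using in_arcsD1 in_arcsD2 by auto
  have sym: "(v, u) \<in> ?R" if "(u, v) \<in> ?R" for u v
    using that arcs_symmetric by blast
  have CV: "?C \<subseteq> ?V"
  proof
    fix x assume "x \<in> ?C"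
    then obtain i where "i < ?k" "x = ys ! i" by (auto simp: in_set_conv_nth)
    then show "x \<in> ?V" using cyc[of i] RV by auto
  qed
  have reach: "\<exists>w\<in>?C. (v, w) \<in> ?R\<^sup>*" if v: "v \<in> ?V" for v
  proof -
    have y: "ys ! 0 \<in> ?C" using ys(2) by (intro nth_mem) linarith
    have "strongly_connected (with_proj G)"
      using conn symmetric_connected_imp_strongly_connected sym_arcs by blast
    then have "v \<rightarrow>\<^sup>*\<^bsub>with_proj G\<^esub> ys ! 0"
      using v y CV by (auto simp: strongly_connected_def)
    then have "(v, ys ! 0) \<in> ?R\<^sup>*"
      unfolding reachable_def by (auto dest!: rtrancl_on_rtranclI simp: arcs_ends_conv)
    then show ?thesis using y by blast
  qed
  have "\<exists>par (h :: 'a \<Rightarrow> nat).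
    (\<forall>v\<in>?V - ?C. par v \<in> ?V \<and> (v, par v) \<in> ?R \<and> h (par v) < h v) \<and>
    (\<forall>v w. (v, w) \<in> ?R \<longrightarrow> (\<exists>i<?k. {v, w} = {ys ! i, ys ! (Suc i mod ?k)}) \<or>
      v \<notin> ?C \<and> w = par v \<or> w \<notin> ?C \<and> v = par w)"
    by (rule connected_unicyclic_structure[OF _ RV CV ys cyc reach card])
      (simp_all add: finite_verts)
  then obtain par and h :: "'a \<Rightarrow> nat"
    where par: "\<And>v. v \<in> ?V - ?C \<Longrightarrow> par v \<in> ?V \<and> (v, par v) \<in> ?R \<and> h (par v) < h v"
    and edges: "\<And>v w. (v, w) \<in> ?R \<Longrightarrow> (\<exists>i<?k. {v, w} = {ys ! i, ys ! (Suc i mod ?k)}) \<or>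
      v \<notin> ?C \<and> w = par v \<or> w \<notin> ?C \<and> v = par w"
    by metis
  have k0: "0 < ?k" using ys(2) by linarith
  have Suc_less: "Suc i mod ?k < ?k" for i using k0 by simp
  show ?thesis
  proof (rule Im_det_hanging_trees[where C = ?C and par = par and h = h])
    show "v \<in> ?C \<and> w \<in> ?C \<or> v \<notin> ?C \<and> w = par v \<or> w \<notin> ?C \<and> v = par w" if "(v, w) \<in> ?R" for v w
      using edges[OF that] Suc_less nth_mem by (metis doubleton_eq_iff)
    show "par v \<in> ?V \<and> (v, par v) \<in> ?R \<and> (par v, v) \<in> ?R \<and> h (par v) < h v"
      if "v \<in> ?V - ?C" for v
      using par[OF that] sym by blast
    show "\<exists>r>0. Im (det_on ?C (weighted_mat d ?E)) = r * Im (\<i> ^ length c)" for d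
    proof -
      have "bij_betw ((!) ys) {0..<?k} ?C"
        using bij_betw_nth[OF ys(1), of "{0..<?k}" ?C] by (simp add: lessThan_atLeast0)
      then have "det_on ?C (weighted_mat d ?E)
          = det_on {0..<?k} (\<lambda>i j. weighted_mat d ?E (ys ! i) (ys ! j))"
        by (rule det_on_reindex) simp
      also have "\<dots> = det_on {0..<?k} (weighted_mat (\<lambda>i. d (ys ! i)) (cyc_adj ?k))"
      proof (rule det_on_cong)
        fix i j assume ij: "i \<in> {0..<?k}" "j \<in> {0..<?k}"
        then have nth: "ys ! i = ys ! j \<longleftrightarrow> i = j" using ys(1) by (simp add: nth_eq_iff_index_eq)
        \<comment> \<open>The cycle has no chords: an edge inside \<open>?C\<close> is not a parent
          edge, hence is one of the cycle edges.\<close>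
        have "(ys ! i, ys ! j) \<in> ?R \<longleftrightarrow> cyc_adj ?k i j"
        proof
          assume "cyc_adj ?k i j"
          then show "(ys ! i, ys ! j) \<in> ?R" using ij cyc sym by (auto simp: cyc_adj_def)
        next
          assume "(ys ! i, ys ! j) \<in> ?R"
          then obtain m where "m < ?k" "{ys ! i, ys ! j} = {ys ! m, ys ! (Suc m mod ?k)}"
            using edges ij by fastforce
          then have "{i, j} = {m, Suc m mod ?k}"
            using ij ys(1) Suc_less by (auto simp: doubleton_eq_iff nth_eq_iff_index_eq)
          then show "cyc_adj ?k i j" by (auto simp: cyc_adj_def doubleton_eq_iff)
        qed
        then show "weighted_mat d ?E (ys ! i) (ys ! j)
            = weighted_mat (\<lambda>i. d (ys ! i)) (cyc_adj ?k) i j"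
          by (simp add: weighted_mat_def nth)
      qed
      finally show ?thesis using Im_det_cycle[OF ys(2)] len by simp
    qed
  qed (use CV t finite_verts in auto)
qed

lemma adjacency_mat_carrier: "adjacency_mat G vs \<in> carrier_mat (length vs) (length vs)"
  by (simp add: adjacency_mat_def)

text \<open>Sum and difference determine both energies; the difference is the sum of the squares
  taken with the sign of the eigenvalue.\<close>

lemma square_energies_list:
  assumes "graph_spectrum G = mset xs"
  shows "pos_square_energy G + neg_square_energy G = (\<Sum>x\<leftarrow>xs. x\<^sup>2)"
    and "pos_square_energy G - neg_square_energy G = (\<Sum>x\<leftarrow>xs. x * \<bar>x\<bar>)"
  unfolding pos_square_energy_def neg_square_energy_def assms
  by (induction xs) (auto simp: power2_eq_square)

text \<open>A diagonal entry of the squared matrix is the degree of a vertex, so the trace counts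
  the arcs, two for each edge.\<close>

lemma diag_sum_adjacency_mat_square:
  assumes pg: "pair_graph G" and vs: "distinct vs" "set vs = pverts G"
  shows "diag_sum (adjacency_mat G vs * adjacency_mat G vs) = 2 * card (undirected_edges G)"
proof -
  interpret pair_graph G by (rule pg)
  let ?n = "length vs" and ?V = "pverts G" and ?R = "parcs G"
  have RV: "?R \<subseteq> ?V \<times> ?V" using in_arcsD1 in_arcsD2 by auto
  have finV: "finite ?V" using finite_verts by simp
  have sym: "(v, u) \<in> ?R" if "(u, v) \<in> ?R" for u v
    using that arcs_symmetric by blast
  have irr: "(v, v) \<notin> ?R" for v using no_loops' by auto
  have bij: "bij_betw ((!) vs) {..<?n} ?V" using vs by (intro bij_betw_nth) auto
  have "diag_sum (adjacency_mat G vs * adjacency_mat G vs)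
      = (\<Sum>i<?n. \<Sum>j<?n. if (vs ! i, vs ! j) \<in> ?R then 1 else 0)"
    unfolding diag_sum_mult[OF adjacency_mat_carrier adjacency_mat_carrier]
    by (intro sum.cong refl) (auto simp: adjacency_mat_def intro: sym)
  also have "\<dots> = (\<Sum>i<?n. \<Sum>w\<in>?V. if (vs ! i, w) \<in> ?R then 1 else 0)"
    by (intro sum.cong refl sum.reindex_bij_betw[OF bij])
  also have "\<dots> = (\<Sum>v\<in>?V. \<Sum>w\<in>?V. if (v, w) \<in> ?R then 1 else 0)"
    by (rule sum.reindex_bij_betw[OF bij])
  also have "\<dots> = (\<Sum>p\<in>?V \<times> ?V. if p \<in> ?R then 1 else 0)"
    by (simp add: sum.cartesian_product)
  also have "\<dots> = card ?R"
    using finV RV by (simp add: sum.If_cases Int_absorb1)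
  also have "card ?R = 2 * card (undirected_edges G)"
    unfolding undirected_edges_def
    by (rule card_symmetric_rel[OF finite_subset[OF RV] sym irr]) (simp add: finV)
  finally show ?thesis by simp
qed

theorem theorem1p2:
  fixes G :: "'a pair_pre_digraph" and c :: "('a \<times> 'a) awalk" and n k :: nat
  assumes "unicyclic G"
    and "n = card (pverts G)"
    and "undirected_cycle G c"
    and "k = length c"
  shows "(k mod 2 = 0 \<longrightarrow> pos_square_energy G = real n \<and> neg_square_energy G = real n) \<and>
    (k mod 4 = 3 \<longrightarrow> pos_square_energy G > real n \<and> real n > neg_square_energy G) \<and>
    (k mod 4 = 1 \<longrightarrow> pos_square_energy G < real n \<and> real n < neg_square_energy G)"
proof -
  from assms(1) have pg: "pair_graph G" and card: "card (undirected_edges G) = n"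
    unfolding unicyclic_def assms(2) by auto
  interpret pair_graph G by (rule pg)
  have sym: "(v, u) \<in> parcs G" if "(u, v) \<in> parcs G" for u v
    using that arcs_symmetric by blast
  have irr: "(v, v) \<notin> parcs G" for v using no_loops' by auto
  obtain vs where vs: "distinct vs" "set vs = pverts G"
    using finite_distinct_list[of "pverts G"] finite_verts by auto
  then have len: "length vs = n" using distinct_card assms(2) by metis
  define A where "A = adjacency_mat G vs"
  have A: "A \<in> carrier_mat n n" using adjacency_mat_carrier len by (auto simp: A_def)
  have A_nth: "A $$ (i, j) = (if (vs ! i, vs ! j) \<in> parcs G then 1 else 0)" if "i < n" "j < n" for i j
    using that len by (simp add: A_def adjacency_mat_def)
  have "\<exists>xs. char_poly A = (\<Prod>x\<leftarrow>xs. [:- x, 1:])"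
    by (rule symmetric_real_char_poly_splits[OF A]) (auto simp: A_nth intro: sym)
  then obtain xs where xs: "char_poly A = (\<Prod>x\<leftarrow>xs. [:- x, 1:])" by blast
  have spec: "graph_spectrum G = mset xs"
    using graph_spectrum_eq[OF vs] xs proots_prod_linear by (simp add: A_def)
  have "diag_sum A = 0"
    using A by (simp add: diag_sum_def A_nth irr)
  then have sum0: "sum_list xs = 0" using diag_sum_split_char_poly(1)[OF A xs] by simp
  have sum2: "(\<Sum>x\<leftarrow>xs. x\<^sup>2) = 2 * real n"
    using diag_sum_split_char_poly(2)[OF A xs] diag_sum_adjacency_mat_square[OF pg vs] card
    by (simp add: A_def)
  \<comment> \<open>The product over the spectrum is det (t I + i A), whose imaginary part has the
    sign dictated by the cycle length.\<close>
  have Im: "\<exists>r>0. Im (\<Prod>x\<leftarrow>xs. of_real t + \<i> * of_real x) = r * Im (\<i> ^ k)" if t: "t > 0" for t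
  proof -
    let ?M = "weighted_mat (\<lambda>_. t) (\<lambda>v w. (v, w) \<in> parcs G)"
    have bij: "bij_betw ((!) vs) {0..<n} (pverts G)"
      using vs len by (intro bij_betw_nth) (auto simp: lessThan_atLeast0)
    have "(\<Prod>x\<leftarrow>xs. of_real t + \<i> * of_real x)
        = det (of_real t \<cdot>\<^sub>m 1\<^sub>m n + \<i> \<cdot>\<^sub>m map_mat of_real A)"
      by (rule det_shifted_imaginary[OF A xs, symmetric])
    also have "\<dots> = det_on {0..<n} (\<lambda>i j. (of_real t \<cdot>\<^sub>m 1\<^sub>m n + \<i> \<cdot>\<^sub>m map_mat of_real A) $$ (i, j))"
      using A by (intro det_eq_det_on) auto
    also have "\<dots> = det_on {0..<n} (\<lambda>i j. ?M (vs ! i) (vs ! j))"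
      using A vs(1) len
      by (intro det_on_cong)
         (auto simp: A_nth weighted_mat_def irr nth_eq_iff_index_eq)
    also have "\<dots> = det_on (pverts G) ?M"
      by (rule det_on_reindex[OF bij, symmetric]) simp
    finally show ?thesis using Im_det_unicyclic[OF assms(1,3) t] assms(4) by simp
  qed
  \<comment> \<open>The energies add up to \<open>2 * real n\<close>, so the sign of their
    difference decides on which side of \<open>n\<close> each one lies.\<close>
  note energies = square_energies_list[OF spec] sum2
  show ?thesis
  proof (intro conjI impI)
    assume "k mod 2 = 0"
    then have "Im (\<i> ^ k) = 0" by (intro Im_i_power) presburger
    then have Im0: "Im (\<Prod>x\<leftarrow>xs. of_real t + \<i> * of_real x) = 0" if "t > 0" for t
      using Im[OF that] by auto
    \<comment> \<open>A vanishing imaginary part satisfies both weak sign conditions, which bound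
      the sum from either side.\<close>
    have "(\<Sum>x\<leftarrow>xs. x * \<bar>x\<bar>) = 0"
      using sum_signed_squares_nonneg(1)[OF sum0] sum_signed_squares_nonpos(1)[OF sum0]
      by (intro antisym) (simp_all add: Im0)
    then show "pos_square_energy G = real n" "neg_square_energy G = real n"
      using energies by linarith+
  next
    assume "k mod 4 = 3"
    then have "Im (\<Prod>x\<leftarrow>xs. of_real t + \<i> * of_real x) < 0" if "t > 0" for t
      using Im[OF that] Im_i_power(2) by auto
    then have "(\<Sum>x\<leftarrow>xs. x * \<bar>x\<bar>) > 0"
      using sum_signed_squares_nonneg(2)[OF sum0] by (simp add: less_imp_le)
    then show "pos_square_energy G > real n" "real n > neg_square_energy G"
      using energies by linarith+
  next
    assume "k mod 4 = 1"
    then have "Im (\<Prod>x\<leftarrow>xs. of_real t + \<i> * of_real x) > 0" if "t > 0" for t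
      using Im[OF that] Im_i_power(3) by auto
    then have "(\<Sum>x\<leftarrow>xs. x * \<bar>x\<bar>) < 0"
      using sum_signed_squares_nonpos(2)[OF sum0] by (simp add: less_imp_le)
    then show "pos_square_energy G < real n" "real n < neg_square_energy G"
      using energies by linarith+
  qed
qed

end
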